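(* In the setting described in the context, let $\epsilon\in(0,1)$, $M=\lfloor K/2\rfloor$, and for $h\in\mathbf{S}^d$, $\alpha>0$ let $$\Psi_+(h,\alpha)=\max_{x\in\mathcal{X}}\left[\alpha\Phi_M(h/\alpha;AxA^T)-\mathrm{Tr}(\bar Qx)\right],\qquad\Psi_-(h,\alpha)=\max_{x\in\mathcal{X}}\left[\alpha\Phi_M(-h/\alpha;AxA^T)+\mathrm{Tr}(\bar Qx)\right],$$ $$\widehat\Psi_\pm(h)=\inf_{\alpha>0}\left\{\Psi_\pm(h,\alpha)+\alpha\ln(2/\epsilon)\right\}.$$ Then $$\widehat\Psi_+(h)=\max_{x\in\mathcal{X}}\inf_{\alpha>0}\left[\alpha\Phi_M(h/\alpha;AxA^T)-\mathrm{Tr}(\bar Qx)+\alpha\ln(2/\epsilon)\right]=\max_{x\in\mathcal{X}}\inf_{\beta>0}\left[\beta\Phi_1(h/\beta;AxA^T)-\mathrm{Tr}(\bar Qx)+\tfrac\beta M\ln(2/\epsilon)\right],$$ $$\widehat\Psi_-(h)=\max_{x\in\mathcal{X}}\inf_{\alpha>0}\left[\alpha\Phi_M(-h/\alpha;AxA^T)+\mathrm{Tr}(\bar Qx)+\alpha\ln(2/\epsilon)\right]=\max_{x\in\mathcal{X}}\inf_{\beta>0}\left[\beta\Phi_1(-h/\beta;AxA^T)+\mathrm{Tr}(\bar Qx)+\tfrac\beta M\ln(2/\epsilon)\right].$$ The functions $\widehat\Psi_\pm$ are real-valued and convex on $\mathbf{S}^d$, and every candidate solution $\bar h\in\mathbf{S}^d$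 to the convex optimization problem $$\mathrm{Opt}=\min_h\left\{\widehat\Psi(h):=\tfrac12\left[\widehat\Psi_+(h)+\widehat\Psi_-(h)\right]\right\}$$ induces the estimate $$\widehat g_{\bar h}(\zeta^K)=\mathrm{Tr}(\bar h\,\omega[\zeta^K])+\kappa(\bar h),\qquad\kappa(h)=\tfrac12\left[\widehat\Psi_-(h)-\widehat\Psi_+(h)\right],$$ of $F(u)$ via observation $\zeta^K$, with $\epsilon$-risk on $U$ not exceeding $\bar\rho=\widehat\Psi(\bar h)$: $$\forall u\in U:\quad\mathrm{Prob}_{\zeta^K\sim P_{Au}^K}\left\{|F(u)-\widehat g_{\bar h}(\zeta^K)|>\bar\rho\right\}\le\epsilon.$$
   Context: Notation: $\mathbf{S}^n$ is the space of real symmetric $n\times n$ matrices; $\Delta_n=\{v\in\mathbf{R}^n:v\ge0,\sum_iv_i=1\}$; $\mathbf{\Delta}^n=\{Z\in\mathbf{S}^n:Z_{ij}\ge0\ \forall i,j,\ \sum_{i,j}Z_{ij}=1\}$; $\mathbf{1}_m$ is the all-ones vector in $\mathbf{R}^m$; $e_1,\dots,e_d$ is the standard basis of $\mathbf{R}^d$. For $\mu\in\Delta_d$, $P_\mu$ is the distribution on $\{e_1,\dots,e_d\}$ with $\mathrm{Prob}\{\zeta=e_j\}=\mu_j$, and $P_\mu^K$ is the distribution of an i.i.d. sample $\zeta^K=(\zeta_1,\dots,\zeta_K)$ from $P_\mu$. Data: an integer $K\ge2$; a $d\times m$ matrix $A$ all of whose columns belong to $\Delta_d$; a nonempty closed set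 $U\subset\Delta_m$; $Q\in\mathbf{S}^m$ and $q\in\mathbf{R}^m$. The functional of interest is $F(u)=u^TQu+2q^Tu$, and for $u\in\Delta_m$ one has $F(u)=u^T\bar Qu$ with $\bar Q=Q+[q\mathbf{1}_m^T+\mathbf{1}_mq^T]$. $\mathcal{X}$ is a convex compact subset of the set of positive semidefinite matrices from $\mathbf{\Delta}^m$ such that $uu^T\in\mathcal{X}$ for all $u\in U$. Quadratic lifting of observations: $$\omega[\zeta^K]=\frac{2}{K(K-1)}\sum_{1\le i<j\le K}\omega_{ij}[\zeta^K],\qquad\omega_{ij}[\zeta^K]=\tfrac12\left[\zeta_i\zeta_j^T+\zeta_j\zeta_i^T\right].$$ For a positive integer $N$, $\Phi_N(h;Z)=N\ln\left(\sum_{i,j=1}^dZ_{ij}\exp\{N^{-1}h_{ij}\}\right):\mathbf{S}^d\times\mathbf{\Delta}^d\to\mathbf{R}$. The $\epsilon$-risk on $U$ of an estimate $\widehat g(\zeta^K)$ is the smallest $\rho$ such that $\mathrm{Prob}_{\zeta^K\sim P_{Au}^K}\{|\widehat g(\zeta^K)-F(u)|>\rho\}\le\epsilon$ for all $u\in U$. *)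

theory Defs
  imports "HOL-Probability.Probability" "HOL-Probability.Product_PMF"
begin

text \<open>
  Vectors in \<open>R^n\<close> have type \<open>real ^ 'n\<close>; a \<open>d\<close> by \<open>m\<close> matrix has type \<open>real ^ 'm ^ 'd\<close>.
\<close>

definition sym_matrices :: "(real ^ 'n ^ 'n) set" where
  "sym_matrices = {Z. transpose Z = Z}"

definition psd_matrices :: "(real ^ 'n ^ 'n) set" where
  "psd_matrices = {Z \<in> sym_matrices. \<forall>v. v \<bullet> (Z *v v) \<ge> 0}"

definition vec_simplex :: "(real ^ 'n) set" where
  "vec_simplex = {v. (\<forall>i. v $ i \<ge> 0) \<and> (\<Sum>i\<in>UNIV. v $ i) = 1}"

definition mat_simplex :: "(real ^ 'n ^ 'n) set" where
  "mat_simplex = {Z \<in> sym_matrices. (\<forall>i j. Z $ i $ j \<ge> 0) \<and> (\<Sum>i\<in>UNIV. \<Sum>j\<in>UNIV. Z $ i $ j) = 1}"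

definition outer :: "real ^ 'n \<Rightarrow> real ^ 'k \<Rightarrow> real ^ 'k ^ 'n" where
  "outer u v = (\<chi> i j. u $ i * v $ j)"

definition is_max_over :: "'a set \<Rightarrow> ('a \<Rightarrow> 'b::linorder) \<Rightarrow> 'b \<Rightarrow> bool" where
  "is_max_over X f v \<longleftrightarrow> (\<exists>x\<in>X. f x = v) \<and> (\<forall>x\<in>X. f x \<le> v)"

definition quad_fun :: "real ^ 'm ^ 'm \<Rightarrow> real ^ 'm \<Rightarrow> real ^ 'm \<Rightarrow> real" where
  "quad_fun Q q u = u \<bullet> (Q *v u) + 2 * (q \<bullet> u)"

definition Qbar :: "real ^ 'm ^ 'm \<Rightarrow> real ^ 'm \<Rightarrow> real ^ 'm ^ 'm" where
  "Qbar Q q = Q + (outer q (vec 1) + outer (vec 1) q)"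

text \<open>
  The law on the standard basis vectors with weights \<open>\<mu>\<close>; meaningful only for
  \<open>\<mu> \<in> vec_simplex\<close>, since \<^const>\<open>embed_pmf\<close> is unspecified on other weights.
\<close>

definition basis_pmf :: "real ^ 'd \<Rightarrow> (real ^ 'd) pmf" where
  "basis_pmf \<mu> = map_pmf (\<lambda>j. axis j 1) (embed_pmf (\<lambda>j. \<mu> $ j))"

lemma pmf_basis_pmf:
  assumes "\<mu> \<in> vec_simplex"
  shows "pmf (basis_pmf \<mu>) (axis j 1) = \<mu> $ j"
proof -
  have nonneg: "\<And>i. 0 \<le> \<mu> $ i" and total: "(\<Sum>i\<in>UNIV. \<mu> $ i) = 1"
    using assms by (auto simp: vec_simplex_def)
  have "(\<integral>\<^sup>+ i. ennreal (\<mu> $ i) \<partial>count_space UNIV) = 1"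
    using nonneg total by (simp add: nn_integral_count_space_finite sum_ennreal)
  then have "pmf (embed_pmf (\<lambda>j. \<mu> $ j)) j = \<mu> $ j"
    using nonneg by (intro pmf_embed_pmf)
  moreover have "inj (\<lambda>j::'a. axis j (1::real))"
    by (auto simp: inj_on_def axis_eq_axis)
  ultimately show ?thesis
    unfolding basis_pmf_def by (subst pmf_map_inj') auto
qed

text \<open>
  An i.i.d. sample \<open>\<zeta> 1, \<dots>, \<zeta> K\<close>, encoded as a function on \<open>nat\<close> that is \<open>0\<close> outside \<open>{1..K}\<close>.
\<close>

definition sample_pmf :: "nat \<Rightarrow> real ^ 'd \<Rightarrow> (nat \<Rightarrow> real ^ 'd) pmf" where
  "sample_pmf K \<mu> = Pi_pmf {1..K} 0 (\<lambda>_. basis_pmf \<mu>)"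

definition omega_pair :: "nat \<Rightarrow> nat \<Rightarrow> (nat \<Rightarrow> real ^ 'd) \<Rightarrow> real ^ 'd ^ 'd" where
  "omega_pair i j \<zeta> = (1 / 2) *\<^sub>R (outer (\<zeta> i) (\<zeta> j) + outer (\<zeta> j) (\<zeta> i))"

definition omega :: "nat \<Rightarrow> (nat \<Rightarrow> real ^ 'd) \<Rightarrow> real ^ 'd ^ 'd" where
  "omega K \<zeta> = (2 / (real K * (real K - 1))) *\<^sub>R
     (\<Sum>(i, j) \<in> {(i, j). 1 \<le> i \<and> i < j \<and> j \<le> K}. omega_pair i j \<zeta>)"

text \<open>
  The least element exists whenever \<open>0 < \<epsilon> < 1\<close>, \<open>U\<close> is a nonempty bounded subset of the simplex,
  \<open>F\<close> is bounded on \<open>U\<close> and the columns of \<open>A\<close> are in the simplex: the sample then has finitely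
  many values, and the tail probability is right-continuous in \<open>\<rho>\<close>.
\<close>

definition eps_risk ::
  "real \<Rightarrow> nat \<Rightarrow> real ^ 'm ^ 'd \<Rightarrow> (real ^ 'm) set \<Rightarrow> (real ^ 'm \<Rightarrow> real) \<Rightarrow>
   ((nat \<Rightarrow> real ^ 'd) \<Rightarrow> real) \<Rightarrow> real" where
  "eps_risk \<epsilon> K A U F g = (LEAST \<rho>. \<forall>u\<in>U.
     measure_pmf.prob (sample_pmf K (A *v u)) {\<zeta>. \<bar>g \<zeta> - F u\<bar> > \<rho>} \<le> \<epsilon>)"

definition Phi :: "nat \<Rightarrow> real ^ 'd ^ 'd \<Rightarrow> real ^ 'd ^ 'd \<Rightarrow> real" where
  "Phi N h Z = real N * ln (\<Sum>i\<in>UNIV. \<Sum>j\<in>UNIV. Z $ i $ j * exp (h $ i $ j / real N))"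

definition Psi_plus ::
  "nat \<Rightarrow> real ^ 'm ^ 'd \<Rightarrow> (real ^ 'm ^ 'm) set \<Rightarrow> real ^ 'm ^ 'm \<Rightarrow> real ^ 'd ^ 'd \<Rightarrow> real \<Rightarrow> real" where
  "Psi_plus M A X Qb h \<alpha> =
     (SUP x\<in>X. \<alpha> * Phi M (h /\<^sub>R \<alpha>) (A ** x ** transpose A) - trace (Qb ** x))"

definition Psi_minus ::
  "nat \<Rightarrow> real ^ 'm ^ 'd \<Rightarrow> (real ^ 'm ^ 'm) set \<Rightarrow> real ^ 'm ^ 'm \<Rightarrow> real ^ 'd ^ 'd \<Rightarrow> real \<Rightarrow> real" where
  "Psi_minus M A X Qb h \<alpha> =
     (SUP x\<in>X. \<alpha> * Phi M (- h /\<^sub>R \<alpha>) (A ** x ** transpose A) + trace (Qb ** x))"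

text \<open>
  The infima over \<open>\<alpha> > 0\<close> are taken in the extended reals, so that finiteness is a genuine claim.
\<close>

definition Psi_hat_plus ::
  "nat \<Rightarrow> real ^ 'm ^ 'd \<Rightarrow> (real ^ 'm ^ 'm) set \<Rightarrow> real ^ 'm ^ 'm \<Rightarrow> real \<Rightarrow> real ^ 'd ^ 'd \<Rightarrow> ereal" where
  "Psi_hat_plus M A X Qb \<epsilon> h = (INF \<alpha>\<in>{0<..}. ereal (Psi_plus M A X Qb h \<alpha> + \<alpha> * ln (2 / \<epsilon>)))"

definition Psi_hat_minus ::
  "nat \<Rightarrow> real ^ 'm ^ 'd \<Rightarrow> (real ^ 'm ^ 'm) set \<Rightarrow> real ^ 'm ^ 'm \<Rightarrow> real \<Rightarrow> real ^ 'd ^ 'd \<Rightarrow> ereal" where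
  "Psi_hat_minus M A X Qb \<epsilon> h = (INF \<alpha>\<in>{0<..}. ereal (Psi_minus M A X Qb h \<alpha> + \<alpha> * ln (2 / \<epsilon>)))"

definition Psi_hat ::
  "nat \<Rightarrow> real ^ 'm ^ 'd \<Rightarrow> (real ^ 'm ^ 'm) set \<Rightarrow> real ^ 'm ^ 'm \<Rightarrow> real \<Rightarrow> real ^ 'd ^ 'd \<Rightarrow> real" where
  "Psi_hat M A X Qb \<epsilon> h =
     (real_of_ereal (Psi_hat_plus M A X Qb \<epsilon> h) + real_of_ereal (Psi_hat_minus M A X Qb \<epsilon> h)) / 2"

definition kappa ::
  "nat \<Rightarrow> real ^ 'm ^ 'd \<Rightarrow> (real ^ 'm ^ 'm) set \<Rightarrow> real ^ 'm ^ 'm \<Rightarrow> real \<Rightarrow> real ^ 'd ^ 'd \<Rightarrow> real" where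
  "kappa M A X Qb \<epsilon> h =
     (real_of_ereal (Psi_hat_minus M A X Qb \<epsilon> h) - real_of_ereal (Psi_hat_plus M A X Qb \<epsilon> h)) / 2"

definition g_hat ::
  "nat \<Rightarrow> real ^ 'm ^ 'd \<Rightarrow> (real ^ 'm ^ 'm) set \<Rightarrow> real ^ 'm ^ 'm \<Rightarrow> real \<Rightarrow> real ^ 'd ^ 'd \<Rightarrow>
   (nat \<Rightarrow> real ^ 'd) \<Rightarrow> real" where
  "g_hat K A X Qb \<epsilon> h \<zeta> = trace (h ** omega K \<zeta>) + kappa (K div 2) A X Qb \<epsilon> h"

end

theory Submission
  imports Defs "HOL-Combinatorics.Permutations"
begin

text \<open>
Everything rests on one function, the perspective
\<open>t * ln (\<Sum>i j. Z i j * exp (h i j / t))\<close> of log-sum-exp: both \<open>\<alpha> * \<Phi>\<^sub>M(h / \<alpha>; Z)\<close> (with \<open>t = M * \<alpha>\<close>) and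
\<open>\<beta> * \<Phi>\<^sub>1(h / \<beta>; Z)\<close> (with \<open>t = \<beta>\<close>) are values of it, so the substitution \<open>\<beta> = M * \<alpha>\<close> identifies the two
formulas for each bound. The perspective is jointly convex in \<open>(h, t)\<close>
(\<open>perspective_lse_convex\<close>) and concave in the weights \<open>Z\<close> (\<open>perspective_lse_concave\<close>). Joint
convexity survives the maximum over \<open>x\<close> and the infimum over \<open>\<alpha>\<close>, whence convexity of the bounds
in \<open>h\<close>. Concavity in \<open>x\<close> together with convexity in \<open>\<alpha>\<close> gives the exchange of maximum and
infimum: \<open>minimax_attained\<close> produces one \<open>x\<close> that is optimal against all \<open>\<alpha>\<close> at once. The bounds
are finite because the perspective is at least the smallest entry of \<open>h\<close> and \<open>ln (2 / \<epsilon>) > 0\<close>.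

For the risk, the lifted observation is a U-statistic of order two. Following Hoeffding, it is
the average, over the permutations of the sample, of the mean of \<open>M\<close> terms that involve pairwise
disjoint pairs of observations (\<open>trace_omega_eq_average\<close>). Jensen's inequality for the exponential
reduces its exponential moment to that of \<open>M\<close> independent pairs, and the latter is precisely
\<open>exp (\<Phi>\<^sub>M(h / \<alpha>; \<mu> \<mu>\<^sup>T))\<close> with \<open>\<mu> = A u\<close> (\<open>exp_moment_trace_omega\<close>). Since
\<open>A (u u\<^sup>T) A\<^sup>T = \<mu> \<mu>\<^sup>T\<close> and \<open>u u\<^sup>T\<close> belongs to the lifted signal set, Markov's inequality gives for each
\<open>\<alpha>\<close> a one-sided deviation bound with failure probability \<open>\<epsilon> / 2\<close>; right-continuity of
tail probabilities passes it to the infimum over \<open>\<alpha>\<close> (\<open>trace_omega_tail\<close>).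

Negating both \<open>h\<close> and the homogenised cost matrix \<open>Qbar Q q\<close> turns the lower bound into the upper one, so only the latter is
analysed. The shift \<open>\<kappa>\<close> centres the estimate between the two one-sided bounds, and a union bound
finishes the proof.
\<close>

section \<open>A minimax theorem with an attained maximum\<close>

text \<open>
The set of pairs dominated by some \<open>(f x, g x)\<close> is convex because \<open>f\<close> and \<open>g\<close> are concave. If it missed
the quadrant above \<open>(v, v)\<close>, a separating line would have a nonnegative normal vector, and its
normalisation would be a mixture of \<open>f\<close> and \<open>g\<close> that is at most \<open>v\<close> on all of \<open>X\<close>.
\<close>

lemma two_point_minimax:
  fixes f g :: "'a::real_vector \<Rightarrow> real"
  assumes X: "convex X" and f: "concave_on X f" and g: "concave_on X g"
    and V: "\<And>l. 0 \<le> l \<Longrightarrow> l \<le> 1 \<Longrightarrow> \<exists>x\<in>X. V \<le> (1 - l) * f x + l * g x"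
    and v: "v < V"
  shows "\<exists>x\<in>X. v \<le> f x \<and> v \<le> g x"
proof (rule ccontr)
  assume no: "\<not> (\<exists>x\<in>X. v \<le> f x \<and> v \<le> g x)"
  define C where "C = {p::real \<times> real. \<exists>x\<in>X. fst p \<le> f x \<and> snd p \<le> g x}"
  define D where "D = {p::real \<times> real. v \<le> fst p \<and> v \<le> snd p}"
  have "convex C"
  proof (rule convexI)
    fix p p' :: "real \<times> real" and a b :: real
    assume p: "p \<in> C" "p' \<in> C" and ab: "0 \<le> a" "0 \<le> b" "a + b = 1"
    then obtain x x' where x: "x \<in> X" "fst p \<le> f x" "snd p \<le> g x"
      and x': "x' \<in> X" "fst p' \<le> f x'" "snd p' \<le> g x'"
      by (auto simp: C_def)
    have "a *\<^sub>R x + b *\<^sub>R x' \<in> X" using X x x' ab by (simp add: convexD)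
    moreover have "a * fst p + b * fst p' \<le> a * f x + b * f x'"
      "a * snd p + b * snd p' \<le> a * g x + b * g x'"
      using x x' ab by (auto intro!: add_mono mult_left_mono)
    moreover have "a * f x + b * f x' \<le> f (a *\<^sub>R x + b *\<^sub>R x')"
      "a * g x + b * g x' \<le> g (a *\<^sub>R x + b *\<^sub>R x')"
      using f g x x' ab unfolding concave_on_iff by blast+
    ultimately show "a *\<^sub>R p + b *\<^sub>R p' \<in> C"
      unfolding C_def by force
  qed
  moreover have "convex D"
  proof (rule convexI)
    fix p p' :: "real \<times> real" and a b :: real
    assume p: "p \<in> D" "p' \<in> D" and ab: "0 \<le> a" "0 \<le> b" "a + b = 1"
    have "v \<le> a * s + b * t" if "v \<le> s" "v \<le> t" for s t
    proof -
      have "v = a * v + b * v" using ab by (metis mult_1 distrib_right)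
      also have "\<dots> \<le> a * s + b * t" using that ab by (intro add_mono mult_left_mono) auto
      finally show ?thesis .
    qed
    then show "a *\<^sub>R p + b *\<^sub>R p' \<in> D" using p by (auto simp: D_def)
  qed
  moreover have "C \<noteq> {}"
    using V[of 0] by (force simp: C_def)
  moreover have "D \<noteq> {}" by (force simp: D_def)
  moreover have "C \<inter> D = {}" using no by (force simp: C_def D_def)
  ultimately obtain a b where a: "a \<noteq> 0" and aC: "\<forall>p\<in>C. a \<bullet> p \<le> b" and aD: "\<forall>p\<in>D. b \<le> a \<bullet> p"
    using separating_hyperplane_sets[of C D] by blast
  obtain r s where rs: "a = (r, s)" by (cases a)
  have up: "b \<le> r * (v + y) + s * (v + z)" if "0 \<le> y" "0 \<le> z" for y z
    using aD that by (auto simp: D_def rs)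
  \<comment> \<open>An affine function bounded below on a half-line has a nonnegative slope.\<close>
  have pos: "0 \<le> r'" if "\<And>y. 0 \<le> y \<Longrightarrow> b \<le> e + r' * y" for r' e :: real
  proof (rule ccontr)
    assume "\<not> 0 \<le> r'"
    then obtain y where "0 \<le> y" "r' * y = - (\<bar>b - e\<bar> + 1)"
      by (intro that[of "(\<bar>b - e\<bar> + 1) / (- r')"] divide_nonneg_pos) auto
    with that[of y] show False by linarith
  qed
  have r: "0 \<le> r" using up[of _ 0] by (intro pos[of "r * v + s * v"]) (simp add: algebra_simps)
  have s: "0 \<le> s" using up[of 0 _] by (intro pos[of "r * v + s * v"]) (simp add: algebra_simps)
  have rs0: "0 < r + s" using r s a rs by (auto simp: zero_prod_def)
  obtain x where x: "x \<in> X" "V \<le> (1 - s / (r + s)) * f x + s / (r + s) * g x"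
    using V[of "s / (r + s)"] r s rs0 by (auto simp: field_simps)
  have "(r + s) * V \<le> (r + s) * ((1 - s / (r + s)) * f x + s / (r + s) * g x)"
    using x rs0 by simp
  also have "\<dots> = r * f x + s * g x"
    using rs0 by (simp add: distrib_left right_diff_distrib left_diff_distrib flip: mult.assoc)
      (simp add: algebra_simps)
  also have "\<dots> \<le> b" using aC x(1) by (force simp: C_def rs)
  also have "\<dots> \<le> (r + s) * v" using up[of 0 0] by (simp add: algebra_simps)
  finally show False using rs0 v by simp
qed

text \<open>
Induction on \<open>I\<close>: by the two-point case, restricting \<open>X\<close> to the convex set where the value at a new
point \<open>a\<close> is at least \<open>v'\<close> keeps the hypothesis true with \<open>v'\<close> in place of \<open>V\<close>. Each step gives up a
little of the level, which is why the conclusion is for \<open>v < V\<close> only.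
\<close>

lemma finite_minimax:
  fixes f :: "'a::real_vector \<Rightarrow> 'b::real_vector \<Rightarrow> real"
  assumes "finite I" "I \<subseteq> S" "convex X" "X \<noteq> {}"
    and "\<And>s. s \<in> S \<Longrightarrow> concave_on X (\<lambda>x. f x s)"
    and "\<And>x. x \<in> X \<Longrightarrow> convex_on S (f x)"
    and "\<And>s. s \<in> S \<Longrightarrow> \<exists>x\<in>X. V \<le> f x s"
    and "v < V"
  shows "\<exists>x\<in>X. \<forall>s\<in>I. v \<le> f x s"
  using assms
proof (induction I arbitrary: X V rule: finite_induct)
  case empty
  then show ?case by auto
next
  case (insert a I)
  note conc = insert.prems(4) and conv = insert.prems(5)
  obtain v' where v': "v < v'" "v' < V" using insert.prems(7) dense by blast
  define Y where "Y = {x\<in>X. v' \<le> f x a}"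
  have aS: "a \<in> S" using insert.prems by auto
  have cY: "convex Y"
  proof (rule convexI)
    fix x y and s t :: real
    assume xy: "x \<in> Y" "y \<in> Y" and st: "0 \<le> s" "0 \<le> t" "s + t = 1"
    have "v' = s * v' + t * v'" using st by (metis mult_1 distrib_right)
    also have "\<dots> \<le> s * f x a + t * f y a"
      using xy st by (intro add_mono mult_left_mono) (auto simp: Y_def)
    also have "\<dots> \<le> f (s *\<^sub>R x + t *\<^sub>R y) a"
      using conc[OF aS] xy st unfolding concave_on_iff Y_def by blast
    finally show "s *\<^sub>R x + t *\<^sub>R y \<in> Y"
      using xy st insert.prems(2) by (auto simp: Y_def convexD)
  qed
  have two: "\<exists>x\<in>Y. v' \<le> f x s" if s: "s \<in> S" for s
  proof -
    have "\<exists>x\<in>X. v' \<le> f x a \<and> v' \<le> f x s"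
    proof (rule two_point_minimax[OF insert.prems(2) conc[OF aS] conc[OF s] _ v'(2)])
      fix l :: real assume l: "0 \<le> l" "l \<le> 1"
      have cS: "convex S" using conv insert.prems(3) convex_on_imp_convex by blast
      obtain x where x: "x \<in> X" "V \<le> f x ((1 - l) *\<^sub>R a + l *\<^sub>R s)"
        using insert.prems(6) convexD[OF cS aS s, of "1 - l" l] l by auto
      then show "\<exists>x\<in>X. V \<le> (1 - l) * f x a + l * f x s"
        using convex_onD[OF conv[OF x(1)] l aS s] by (meson order_trans)
    qed
    then show ?thesis by (auto simp: Y_def)
  qed
  have "\<exists>x\<in>Y. \<forall>s\<in>I. v \<le> f x s"
  proof (rule insert.IH[OF _ cY _ _ _ two v'(1)])
    show "concave_on Y (\<lambda>x. f x s)" if "s \<in> S" for s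
      using conc[OF that] cY unfolding concave_on_iff Y_def by blast
  qed (use insert.prems two[OF aS] in \<open>auto simp: Y_def\<close>)
  then show ?case using v' by (force simp: Y_def)
qed

text \<open>
Compactness turns the finite version into a single \<open>x\<close> good for all of \<open>S\<close>. Indexing the closed
superlevel sets by points \<open>s\<close> and levels \<open>v < V\<close> together recovers the level \<open>V\<close> itself in the limit,
so the maximum is attained.
\<close>

lemma minimax_attained:
  fixes f :: "'a::{real_vector,t2_space} \<Rightarrow> 'b::real_vector \<Rightarrow> real"
  assumes X: "convex X" "compact X" "X \<noteq> {}"
    and conc: "\<And>s. s \<in> S \<Longrightarrow> concave_on X (\<lambda>x. f x s)"
    and cont: "\<And>s. s \<in> S \<Longrightarrow> continuous_on X (\<lambda>x. f x s)"
    and conv: "\<And>x. x \<in> X \<Longrightarrow> convex_on S (f x)"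
    and V: "\<And>s. s \<in> S \<Longrightarrow> \<exists>x\<in>X. V \<le> f x s"
  shows "\<exists>x\<in>X. \<forall>s\<in>S. V \<le> f x s"
proof -
  define F where "F p = {x\<in>X. snd p \<le> f x (fst p)}" for p :: "'b \<times> real"
  have "X \<inter> (\<Inter>p\<in>S \<times> {..<V}. F p) \<noteq> {}"
  proof (rule compact_imp_fip_image[OF X(2)])
    fix p assume "p \<in> S \<times> {..<V}"
    then show "closed (F p)"
      using continuous_closed_preimage[OF cont compact_imp_closed[OF X(2)] closed_atLeast, of "fst p" "snd p"]
      by (auto simp: F_def vimage_def Int_def)
  next
    fix I' assume I: "finite I'" "I' \<subseteq> S \<times> {..<V}"
    \<comment> \<open>Inserting \<open>V - 1\<close> keeps the maximum meaningful for an empty subfamily.\<close>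
    define v where "v = Max (insert (V - 1) (snd ` I'))"
    have "v < V" using I by (auto simp: v_def)
    then obtain x where x: "x \<in> X" "\<forall>s\<in>fst ` I'. v \<le> f x s"
      using finite_minimax[of "fst ` I'" S X f V v, OF _ _ X(1,3) conc conv V] I by fastforce
    moreover have "snd p \<le> v" if "p \<in> I'" for p
      using I that unfolding v_def by (intro Max_ge) auto
    ultimately have "x \<in> F p" if "p \<in> I'" for p
      using that x order_trans[of "snd p" v "f x (fst p)"] unfolding F_def by blast
    then show "X \<inter> \<Inter> (F ` I') \<noteq> {}" using x(1) by blast
  qed
  then obtain x where x: "x \<in> X" "\<And>s v. s \<in> S \<Longrightarrow> v < V \<Longrightarrow> v \<le> f x s"
    by (fastforce simp: F_def)
  then show ?thesis using dense_le by blast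
qed

section \<open>The perspective of log-sum-exp\<close>

definition perspective_lse :: "real ^ 'd ^ 'd \<Rightarrow> real ^ 'd ^ 'd \<Rightarrow> real \<Rightarrow> real" where
  "perspective_lse Z h t = t * ln (\<Sum>i\<in>UNIV. \<Sum>j\<in>UNIV. Z $ i $ j * exp (h $ i $ j / t))"

lemma Phi_eq_perspective_lse:
  assumes "0 < \<alpha>" "0 < N"
  shows "\<alpha> * Phi N (h /\<^sub>R \<alpha>) Z = perspective_lse Z h (real N * \<alpha>)"
  by (simp add: Phi_def perspective_lse_def field_simps)

text \<open>
Joint probability laws of an ordered pair of indices.
\<close>

definition weights :: "(real ^ 'd ^ 'd) set" where
  "weights = {Z. (\<forall>i j. 0 \<le> Z $ i $ j) \<and> (\<Sum>i\<in>UNIV. \<Sum>j\<in>UNIV. Z $ i $ j) = 1}"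

lemma weighted_exp_sum_ge:
  fixes h :: "real ^ 'd ^ 'd"
  assumes Z: "Z \<in> weights" and b: "\<And>i j. b \<le> h $ i $ j"
  shows "exp b \<le> (\<Sum>i\<in>UNIV. \<Sum>j\<in>UNIV. Z $ i $ j * exp (h $ i $ j))"
proof -
  have "exp b = (\<Sum>i\<in>UNIV. \<Sum>j\<in>UNIV. Z $ i $ j * exp b)"
    using Z by (simp add: weights_def flip: sum_distrib_right)
  also have "\<dots> \<le> (\<Sum>i\<in>UNIV. \<Sum>j\<in>UNIV. Z $ i $ j * exp (h $ i $ j))"
    using Z b by (intro sum_mono mult_left_mono) (auto simp: weights_def)
  finally show ?thesis .
qed

lemma matrix_entry_ge_neg_norm: "- norm h \<le> (h :: real ^ 'm ^ 'd) $ i $ j"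
  using Finite_Cartesian_Product.norm_nth_le[of h i] Finite_Cartesian_Product.norm_nth_le[of "h $ i" j]
  by simp

lemma weighted_exp_sum_pos:
  fixes h :: "real ^ 'd ^ 'd"
  assumes "Z \<in> weights"
  shows "0 < (\<Sum>i\<in>UNIV. \<Sum>j\<in>UNIV. Z $ i $ j * exp (h $ i $ j / t))"
proof -
  have "exp (- norm (h /\<^sub>R t)) \<le> (\<Sum>i\<in>UNIV. \<Sum>j\<in>UNIV. Z $ i $ j * exp ((h /\<^sub>R t) $ i $ j))"
    by (intro weighted_exp_sum_ge assms matrix_entry_ge_neg_norm)
  then show ?thesis by (simp add: divide_inverse mult.commute) (smt (verit) exp_gt_zero)
qed

lemma perspective_lse_ge:
  assumes Z: "Z \<in> weights" and t: "0 < t"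
  shows "- norm h \<le> perspective_lse Z h t"
proof -
  have "exp (- norm h / t) \<le> (\<Sum>i\<in>UNIV. \<Sum>j\<in>UNIV. Z $ i $ j * exp ((h /\<^sub>R t) $ i $ j))"
  proof (rule weighted_exp_sum_ge[OF Z])
    show "- norm h / t \<le> (h /\<^sub>R t) $ i $ j" for i j
      using matrix_entry_ge_neg_norm[of h i j] t by (simp add: field_simps)
  qed
  then have "- norm h / t \<le> ln (\<Sum>i\<in>UNIV. \<Sum>j\<in>UNIV. Z $ i $ j * exp (h $ i $ j / t))"
    using weighted_exp_sum_pos[OF Z, of h t] by (simp add: divide_inverse mult.commute ln_ge_iff)
  then show ?thesis
    using t by (simp add: perspective_lse_def field_simps)
qed

text \<open>
This is Hoelder's inequality in logarithmic form. Normalising each exponential by its total mass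
makes both sums equal to one; convexity of the exponential with coefficients
\<open>c = a * t1 / t\<close>, \<open>d = b * t2 / t\<close> then bounds the normalised mixed sum by \<open>c + d = 1\<close>.
\<close>

lemma perspective_lse_convex:
  fixes Z h1 h2 :: "real ^ 'd ^ 'd"
  assumes Z: "Z \<in> weights" and t: "0 < t1" "0 < t2" and ab: "0 \<le> a" "0 \<le> b" "a + b = 1"
  shows "perspective_lse Z (a *\<^sub>R h1 + b *\<^sub>R h2) (a * t1 + b * t2)
           \<le> a * perspective_lse Z h1 t1 + b * perspective_lse Z h2 t2"
proof -
  define S where "S h t = (\<Sum>i\<in>UNIV. \<Sum>j\<in>UNIV. Z $ i $ j * exp (h $ i $ j / t))" for h t
  define t where "t = a * t1 + b * t2"
  define c where "c = a * t1 / t"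
  define d where "d = b * t2 / t"
  define h where "h = a *\<^sub>R h1 + b *\<^sub>R h2"
  have S: "0 < S k s" for k s unfolding S_def by (rule weighted_exp_sum_pos[OF Z])
  have t0: "0 < t" unfolding t_def using t ab
    by (cases "a = 0") (auto intro!: add_pos_nonneg mult_pos_pos mult_nonneg_nonneg)
  have cd: "0 \<le> c" "0 \<le> d" "c + d = 1" using t ab t0
    by (auto simp: c_def d_def t_def simp flip: add_divide_distrib)
  \<comment> \<open>The logarithm of the claimed upper bound for the mixed sum.\<close>
  define e where "e = c * ln (S h1 t1) + d * ln (S h2 t2)"
  have exp_eq: "h $ i $ j / t - e =
      c * (h1 $ i $ j / t1 - ln (S h1 t1)) + d * (h2 $ i $ j / t2 - ln (S h2 t2))" for i j
  proof -
    have "h $ i $ j / t = c * (h1 $ i $ j / t1) + d * (h2 $ i $ j / t2)"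
      using t by (simp add: h_def c_def d_def add_divide_distrib)
    then show ?thesis by (simp add: e_def algebra_simps)
  qed
  have normalized: "(\<Sum>i\<in>UNIV. \<Sum>j\<in>UNIV. Z $ i $ j * exp (k $ i $ j / s - ln (S k s))) = 1" for k s
  proof -
    have "(\<Sum>i\<in>UNIV. \<Sum>j\<in>UNIV. Z $ i $ j * exp (k $ i $ j / s - ln (S k s))) = S k s / S k s"
      using S[of k s] by (simp add: exp_diff flip: sum_divide_distrib) (simp add: S_def)
    then show ?thesis using S[of k s] by simp
  qed
  have "S h t / exp e = (\<Sum>i\<in>UNIV. \<Sum>j\<in>UNIV. Z $ i $ j * exp (h $ i $ j / t - e))"
    by (simp add: S_def sum_divide_distrib exp_diff)
  also have "\<dots> \<le> (\<Sum>i\<in>UNIV. \<Sum>j\<in>UNIV. Z $ i $ j *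
      (c * exp (h1 $ i $ j / t1 - ln (S h1 t1)) + d * exp (h2 $ i $ j / t2 - ln (S h2 t2))))"
  proof (intro sum_mono mult_left_mono)
    fix i j
    show "exp (h $ i $ j / t - e) \<le>
      c * exp (h1 $ i $ j / t1 - ln (S h1 t1)) + d * exp (h2 $ i $ j / t2 - ln (S h2 t2))"
      unfolding exp_eq using exp_convex cd unfolding convex_on_def by force
  qed (use Z in \<open>auto simp: weights_def\<close>)
  also have "\<dots> = c * (\<Sum>i\<in>UNIV. \<Sum>j\<in>UNIV. Z $ i $ j * exp (h1 $ i $ j / t1 - ln (S h1 t1)))
      + d * (\<Sum>i\<in>UNIV. \<Sum>j\<in>UNIV. Z $ i $ j * exp (h2 $ i $ j / t2 - ln (S h2 t2)))"
    by (simp add: sum_distrib_left sum.distrib distrib_left mult.left_commute)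
  also have "\<dots> = 1" unfolding normalized using cd by simp
  finally have "S h t \<le> exp e" by (simp add: field_simps)
  then have "ln (S h t) \<le> e" using S by (metis ln_exp ln_mono exp_gt_zero)
  then have "t * ln (S h t) \<le> t * e" using t0 by simp
  also have "t * e = a * (t1 * ln (S h1 t1)) + b * (t2 * ln (S h2 t2))"
    using t0 by (simp add: e_def c_def d_def field_simps)
  finally show ?thesis by (simp add: perspective_lse_def S_def h_def t_def)
qed

lemma perspective_lse_concave:
  assumes Z: "Z1 \<in> weights" "Z2 \<in> weights" and t: "0 < t"
    and ab: "0 \<le> a" "0 \<le> b" "a + b = 1"
  shows "a * perspective_lse Z1 h t + b * perspective_lse Z2 h t
           \<le> perspective_lse (a *\<^sub>R Z1 + b *\<^sub>R Z2) h t"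
proof -
  define S where "S Z = (\<Sum>i\<in>UNIV. \<Sum>j\<in>UNIV. Z $ i $ j * exp (h $ i $ j / t))" for Z
  have lin: "S (a *\<^sub>R Z1 + b *\<^sub>R Z2) = a * S Z1 + b * S Z2"
    by (simp add: S_def sum_distrib_left sum.distrib algebra_simps)
  have "a * ln (S Z1) + b * ln (S Z2) \<le> ln (a * S Z1 + b * S Z2)"
    using ln_concave weighted_exp_sum_pos[OF Z(1), of h t] weighted_exp_sum_pos[OF Z(2), of h t] ab
    unfolding concave_on_iff S_def by force
  then have "t * (a * ln (S Z1) + b * ln (S Z2)) \<le> t * ln (S (a *\<^sub>R Z1 + b *\<^sub>R Z2))"
    using t unfolding lin by simp
  then show ?thesis by (simp add: perspective_lse_def S_def algebra_simps)
qed

lemma perspective_lse_continuous_on: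
  "continuous_on weights (\<lambda>Z. perspective_lse Z h t)"
  unfolding perspective_lse_def
  by (intro continuous_intros ballI) (rule less_imp_neq[THEN not_sym], rule weighted_exp_sum_pos)

text \<open>
If \<open>x\<close> is the joint law of two labels and each label \<open>k\<close> is sent through the channel with output law
column \<open>k\<close> of \<open>A\<close>, then \<open>A x A\<^sup>T\<close> is the joint law of the outputs.
\<close>

lemma congruence_weights:
  fixes A :: "real ^ 'm ^ 'd"
  assumes A: "\<And>j. column j A \<in> vec_simplex" and x: "x \<in> weights"
  shows "A ** x ** transpose A \<in> weights"
proof -
  have A0: "0 \<le> A $ i $ k" for i k using A by (auto simp: vec_simplex_def column_def)
  have A1: "(\<Sum>i\<in>UNIV. A $ i $ k) = 1" for k using A[of k] by (auto simp: vec_simplex_def column_def)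
  have x0: "0 \<le> x $ k $ l" for k l using x by (auto simp: weights_def)
  have "(\<Sum>i\<in>UNIV. \<Sum>j\<in>UNIV. (A ** x ** transpose A) $ i $ j)
      = (\<Sum>i\<in>UNIV. \<Sum>j\<in>UNIV. \<Sum>l\<in>UNIV. (A ** x) $ i $ l * A $ j $ l)"
    by (simp add: matrix_matrix_mult_def transpose_def)
  also have "\<dots> = (\<Sum>i\<in>UNIV. \<Sum>l\<in>UNIV. (A ** x) $ i $ l * (\<Sum>j\<in>UNIV. A $ j $ l))"
    unfolding sum_distrib_left by (intro sum.cong refl sum.swap)
  also have "\<dots> = (\<Sum>l\<in>UNIV. \<Sum>i\<in>UNIV. \<Sum>k\<in>UNIV. A $ i $ k * x $ k $ l)"
    by (subst sum.swap) (simp add: A1 matrix_matrix_mult_def)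
  also have "\<dots> = (\<Sum>l\<in>UNIV. \<Sum>k\<in>UNIV. (\<Sum>i\<in>UNIV. A $ i $ k) * x $ k $ l)"
    unfolding sum_distrib_right by (intro sum.cong refl sum.swap)
  also have "\<dots> = 1" using x by (subst sum.swap) (simp add: A1 weights_def)
  finally show ?thesis
    using A0 x0 by (auto simp: weights_def matrix_matrix_mult_def transpose_def
        intro!: sum_nonneg mult_nonneg_nonneg)
qed

section \<open>Pair averages as averages over permutations\<close>

lemma permutation_mapping_pair:
  assumes "a \<in> S" "b \<in> S" "a \<noteq> b" "a' \<in> S" "b' \<in> S" "a' \<noteq> b'"
  obtains t where "t permutes S" "t a = a'" "t b = b'"
proof
  define c where "c = Transposition.transpose a a' b"
  have c: "c \<in> S" "c \<noteq> a'" using assms by (auto simp: c_def Transposition.transpose_def)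
  let ?t = "Transposition.transpose c b' \<circ> Transposition.transpose a a'"
  show "?t permutes S" using assms c by (intro permutes_compose permutes_swap_id)
  show "?t a = a'" using assms c by (simp add: Transposition.transpose_def)
  show "?t b = b'" using c_def by simp
qed

definition off_diagonal :: "'a set \<Rightarrow> ('a \<times> 'a) set" where
  "off_diagonal S = {(i, j). i \<in> S \<and> j \<in> S \<and> i \<noteq> j}"

lemma card_off_diagonal:
  assumes "finite S"
  shows "card (off_diagonal S) = card S * (card S - 1)"
proof -
  have "off_diagonal S = Sigma S (\<lambda>i. S - {i})" by (auto simp: off_diagonal_def)
  then show ?thesis using assms by (simp add: card_Diff_singleton)
qed

text \<open>
A random permutation sends any fixed ordered pair of distinct points to a uniformly distributed
one: the sum on the left does not depend on the pair, since permutations act transitively on such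
pairs, so it can be averaged over all of them, and each permutation merely reindexes that average.
\<close>

lemma sum_over_permutations_of_pair:
  fixes w :: "'a \<Rightarrow> 'a \<Rightarrow> real"
  assumes fin: "finite S" and ab: "(a, b) \<in> off_diagonal S"
  shows "card (off_diagonal S) * (\<Sum>p | p permutes S. w (p a) (p b))
       = card {p. p permutes S} * (\<Sum>(i, j)\<in>off_diagonal S. w i j)"
proof -
  define G where "G i j = (\<Sum>p | p permutes S. w (p i) (p j))" for i j
  have G: "G i j = G a b" if ij: "(i, j) \<in> off_diagonal S" for i j
  proof -
    obtain t where t: "t permutes S" "t a = i" "t b = j"
      using permutation_mapping_pair[of a S b i j] ij ab unfolding off_diagonal_def by blast
    then show ?thesis unfolding G_def
      using sum_permutations_compose_right[OF t(1), of "\<lambda>p. w (p a) (p b)"] by simp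
  qed
  have reindex: "(\<Sum>(i, j)\<in>off_diagonal S. w (p i) (p j)) = (\<Sum>(i, j)\<in>off_diagonal S. w i j)"
    if "p permutes S" for p
    using permutes_inverses[OF that] permutes_in_image[OF that] permutes_in_image[OF permutes_inv[OF that]]
    by (intro sum.reindex_bij_witness[of _ "map_prod (inv p) (inv p)" "map_prod p p"])
      (auto simp: off_diagonal_def inj_eq[OF permutes_inj[OF permutes_inv[OF that]]]
        inj_eq[OF permutes_inj[OF that]])
  have "card (off_diagonal S) * G a b = (\<Sum>(i, j)\<in>off_diagonal S. G i j)"
    using G by (simp add: case_prod_unfold sum.cong[where h = "\<lambda>_. G a b"])
  also have "\<dots> = (\<Sum>p | p permutes S. \<Sum>(i, j)\<in>off_diagonal S. w (p i) (p j))"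
    unfolding G_def case_prod_unfold by (rule sum.swap)
  also have "\<dots> = card {p. p permutes S} * (\<Sum>(i, j)\<in>off_diagonal S. w i j)"
    using reindex by simp
  finally show ?thesis by (simp add: G_def)
qed

lemma trace_mult_outer: "trace (h ** outer u v) = v \<bullet> (h *v u)"
  by (simp add: trace_def outer_def matrix_matrix_mult_def matrix_vector_mult_def inner_vec_def
      sum_distrib_left ac_simps)

lemma trace_mult_add: "trace (h ** (x + y)) = trace (h ** x) + trace (h ** y)"
  for h :: "real ^ 'd ^ 'd"
  by (simp add: matrix_add_ldistrib trace_add)

lemma trace_mult_scaleR: "trace (h ** (c *\<^sub>R x)) = c * trace (h ** x)"
  for h :: "real ^ 'd ^ 'd"
  by (simp add: trace_def matrix_matrix_mult_def sum_distrib_left mult.left_commute)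

lemma trace_mult_sum: "trace (h ** (\<Sum>i\<in>I. x i)) = (\<Sum>i\<in>I. trace (h ** x i))"
  for h :: "real ^ 'd ^ 'd"
proof (cases "finite I")
  case True
  then show ?thesis by (induction I rule: finite_induct) (auto simp: trace_mult_add, simp add: trace_def matrix_matrix_mult_def)
qed (simp add: trace_def matrix_matrix_mult_def)

text \<open>
Each unordered pair contributes both of its orderings through the symmetrised product, so the
normalised sum over \<open>i < j\<close> is a mean over ordered pairs of distinct positions.
\<close>

lemma trace_omega:
  fixes h :: "real ^ 'd ^ 'd"
  assumes K: "2 \<le> K"
  shows "trace (h ** omega K \<zeta>) =
    (\<Sum>(i, j)\<in>off_diagonal {1..K}. \<zeta> j \<bullet> (h *v \<zeta> i)) / card (off_diagonal {1..K})"
proof -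
  define w where "w i j = \<zeta> j \<bullet> (h *v \<zeta> i)" for i j
  define L where "L = {(i, j). 1 \<le> i \<and> i < j \<and> j \<le> K}"
  have od: "off_diagonal {1..K} = L \<union> prod.swap ` L"
    unfolding off_diagonal_def L_def by (auto simp: image_iff)
  have "finite L" by (rule finite_subset[of _ "{1..K} \<times> {1..K}"]) (auto simp: L_def)
  then have "(\<Sum>(i, j)\<in>off_diagonal {1..K}. w i j) = (\<Sum>(i, j)\<in>L. w i j) + (\<Sum>p\<in>prod.swap ` L. w (fst p) (snd p))"
    unfolding od case_prod_unfold by (intro sum.union_disjoint) (auto simp: L_def)
  also have "(\<Sum>p\<in>prod.swap ` L. w (fst p) (snd p)) = (\<Sum>(i, j)\<in>L. w j i)"
    by (subst sum.reindex) (auto simp: case_prod_unfold intro: inj_onI)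
  finally have sums: "(\<Sum>(i, j)\<in>off_diagonal {1..K}. w i j) = (\<Sum>(i, j)\<in>L. w i j + w j i)"
    by (simp add: sum.distrib case_prod_unfold)
  have card: "real (card (off_diagonal {1..K})) = real K * (real K - 1)"
    using K by (simp add: card_off_diagonal of_nat_diff)
  have pair: "trace (h ** omega_pair i j \<zeta>) = (w i j + w j i) / 2" for i j
    by (simp add: omega_pair_def trace_mult_scaleR trace_mult_add trace_mult_outer w_def)
  have "trace (h ** omega K \<zeta>) = 2 / (real K * (real K - 1)) * (\<Sum>(i, j)\<in>L. (w i j + w j i) / 2)"
    unfolding omega_def trace_mult_scaleR trace_mult_sum case_prod_unfold pair L_def ..
  also have "\<dots> = (\<Sum>(i, j)\<in>off_diagonal {1..K}. w i j) / card (off_diagonal {1..K})"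
    unfolding sums card by (simp add: case_prod_unfold flip: sum_divide_distrib)
  finally show ?thesis by (simp add: w_def)
qed

text \<open>
Hoeffding's decomposition of the U-statistic: for a fixed permutation the inner mean runs over the disjoint pairs
\<open>(1, 2), (3, 4), \<dots>, (2 M - 1, 2 M)\<close> of positions, whose terms are independent.
\<close>

lemma trace_omega_eq_average:
  fixes h :: "real ^ 'd ^ 'd"
  assumes K: "2 \<le> K" and M: "M = K div 2"
  shows "trace (h ** omega K \<zeta>) =
    (\<Sum>p | p permutes {1..K}. 1 / card {p. p permutes {1..K}} *
       ((\<Sum>l<M. \<zeta> (p (2 * l + 2)) \<bullet> (h *v \<zeta> (p (2 * l + 1)))) / real M))"
proof -
  let ?P = "{p. p permutes {1..K}}"
  define w where "w i j = \<zeta> j \<bullet> (h *v \<zeta> i)" for i j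
  have M0: "0 < M" using K M by simp
  have P0: "card ?P \<noteq> 0" by (simp add: card_permutations[of _ K])
  have c0: "card (off_diagonal {1..K}) \<noteq> 0" using K by (simp add: card_off_diagonal)
  have "(\<Sum>p\<in>?P. w (p (2 * l + 1)) (p (2 * l + 2))) = card ?P * trace (h ** omega K \<zeta>)"
    if "l < M" for l
  proof -
    have "(2 * l + 1, 2 * l + 2) \<in> off_diagonal {1..K}" using that M by (auto simp: off_diagonal_def)
    from sum_over_permutations_of_pair[OF _ this, of w] c0
    show ?thesis by (simp add: trace_omega[OF K] w_def field_simps)
  qed
  then have "(\<Sum>l<M. \<Sum>p\<in>?P. w (p (2 * l + 1)) (p (2 * l + 2))) = real M * (card ?P * trace (h ** omega K \<zeta>))"
    by simp
  then have "trace (h ** omega K \<zeta>) = (\<Sum>p\<in>?P. \<Sum>l<M. w (p (2 * l + 1)) (p (2 * l + 2))) / (card ?P * real M)"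
    using M0 P0 by (subst sum.swap) simp
  then show ?thesis by (simp add: w_def sum_divide_distrib mult.commute)
qed

section \<open>Exponential moments and tails of the lifted observation\<close>

text \<open>
Independence enters here: factors that read disjoint pairs of coordinates of a product law
integrate to a product. One pair of coordinates is split off at a time.
\<close>

lemma nn_integral_prod_disjoint_pairs:
  fixes \<phi> :: "'a \<Rightarrow> 'a \<Rightarrow> ennreal" and a b :: "nat \<Rightarrow> 'i"
  assumes "finite I" "a ` {..<M} \<subseteq> I" "b ` {..<M} \<subseteq> I"
    and "inj_on a {..<M}" "inj_on b {..<M}" "a ` {..<M} \<inter> b ` {..<M} = {}"
  shows "(\<integral>\<^sup>+\<zeta>. (\<Prod>l<M. \<phi> (\<zeta> (a l)) (\<zeta> (b l))) \<partial>Pi_pmf I d (\<lambda>_. p))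
       = (\<integral>\<^sup>+v. \<integral>\<^sup>+w. \<phi> v w \<partial>p \<partial>p) ^ M"
  using assms
proof (induction M arbitrary: I)
  case 0
  then show ?case by simp
next
  case (Suc M)
  define J where "J = I - {a M, b M}"
  have ne: "a M \<noteq> b M" using Suc.prems(6) by auto
  have I: "I = insert (a M) (insert (b M) J)" "finite J" "b M \<notin> J" "a M \<notin> insert (b M) J"
    using Suc.prems ne by (auto simp: J_def)
  have apart: "a l \<noteq> a M" "b l \<noteq> b M" "a l \<noteq> b M" "b l \<noteq> a M" if "l < M" for l
  proof -
    show "a l \<noteq> a M" using inj_onD[OF Suc.prems(4), of l M] that by auto
    show "b l \<noteq> b M" using inj_onD[OF Suc.prems(5), of l M] that by auto
    have "a l \<in> a ` {..<Suc M}" "b M \<in> b ` {..<Suc M}" "b l \<in> b ` {..<Suc M}" "a M \<in> a ` {..<Suc M}"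
      using that by auto
    then show "a l \<noteq> b M" "b l \<noteq> a M" using Suc.prems(6) by (metis IntI empty_iff)+
  qed
  have "(\<integral>\<^sup>+\<zeta>. (\<Prod>l<Suc M. \<phi> (\<zeta> (a l)) (\<zeta> (b l))) \<partial>Pi_pmf I d (\<lambda>_. p))
    = (\<integral>\<^sup>+v. \<integral>\<^sup>+w. \<integral>\<^sup>+\<zeta>. (\<Prod>l<Suc M. \<phi> (((\<zeta>(b M := w))(a M := v)) (a l)) (((\<zeta>(b M := w))(a M := v)) (b l)))
         \<partial>Pi_pmf J d (\<lambda>_. p) \<partial>p \<partial>p)"
    unfolding I(1) using I
    by (simp add: Pi_pmf_insert nn_integral_pair_pmf' case_prod_unfold
        del: fun_upd_apply prod.lessThan_Suc)
  also have "\<dots> = (\<integral>\<^sup>+v. \<integral>\<^sup>+w. \<integral>\<^sup>+\<zeta>. \<phi> v w * (\<Prod>l<M. \<phi> (\<zeta> (a l)) (\<zeta> (b l)))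
         \<partial>Pi_pmf J d (\<lambda>_. p) \<partial>p \<partial>p)"
    using ne apart by (intro nn_integral_cong) (auto simp: mult.commute intro!: arg_cong2[where f = "(*)"] prod.cong)
  also have "\<dots> = (\<integral>\<^sup>+v. \<integral>\<^sup>+w. \<phi> v w \<partial>p \<partial>p)
      * (\<integral>\<^sup>+\<zeta>. (\<Prod>l<M. \<phi> (\<zeta> (a l)) (\<zeta> (b l))) \<partial>Pi_pmf J d (\<lambda>_. p))"
    by (simp add: nn_integral_cmult nn_integral_multc)
  also have "(\<integral>\<^sup>+\<zeta>. (\<Prod>l<M. \<phi> (\<zeta> (a l)) (\<zeta> (b l))) \<partial>Pi_pmf J d (\<lambda>_. p))
      = (\<integral>\<^sup>+v. \<integral>\<^sup>+w. \<phi> v w \<partial>p \<partial>p) ^ M"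
  proof (rule Suc.IH)
    show "finite J" using I by simp
    show "a ` {..<M} \<subseteq> J" "b ` {..<M} \<subseteq> J"
      using apart Suc.prems(2,3) by (auto simp: J_def image_subset_iff)
    show "a ` {..<M} \<inter> b ` {..<M} = {}"
      using Suc.prems(6) image_mono[of "{..<M}" "{..<Suc M}" a] image_mono[of "{..<M}" "{..<Suc M}" b]
      by (simp only: lessThan_subset_iff) (meson disjoint_iff le_Suc_eq order_refl subsetD)
  qed (use Suc.prems(4,5) in \<open>auto intro: inj_on_subset\<close>)
  finally show ?case by simp
qed

lemma nn_integral_basis_pmf:
  assumes "\<mu> \<in> vec_simplex"
  shows "(\<integral>\<^sup>+v. f v \<partial>basis_pmf \<mu>) = (\<Sum>i\<in>UNIV. f (axis i 1) * ennreal (\<mu> $ i))"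
proof -
  let ?e = "embed_pmf (\<lambda>j. \<mu> $ j)"
  have "pmf ?e i = \<mu> $ i" for i
  proof -
    have "inj (\<lambda>j::'a. axis j (1::real))"
      by (auto simp: inj_on_def axis_eq_axis)
    then have "pmf (basis_pmf \<mu>) (axis i 1) = pmf ?e i"
      unfolding basis_pmf_def by (rule pmf_map_inj')
    then show ?thesis using pmf_basis_pmf[OF assms] by simp
  qed
  then show ?thesis
    unfolding basis_pmf_def nn_integral_map_pmf
    by (simp add: nn_integral_measure_pmf nn_integral_count_space_finite mult.commute)
qed

lemma outer_weights:
  assumes "\<mu> \<in> vec_simplex"
  shows "outer \<mu> \<mu> \<in> weights"
  using assms by (auto simp: weights_def vec_simplex_def outer_def simp flip: sum_distrib_left)

lemma basis_pair_exp_moment: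
  fixes h :: "real ^ 'd ^ 'd"
  assumes mu: "\<mu> \<in> vec_simplex"
  shows "(\<integral>\<^sup>+v. \<integral>\<^sup>+w. ennreal (exp (w \<bullet> (h *v v) / t)) \<partial>basis_pmf \<mu> \<partial>basis_pmf \<mu>)
    = ennreal (\<Sum>i\<in>UNIV. \<Sum>j\<in>UNIV. outer \<mu> \<mu> $ i $ j * exp (h $ i $ j / t))"
proof -
  have nn: "0 \<le> \<mu> $ i" for i using mu by (auto simp: vec_simplex_def)
  have "(axis j 1) \<bullet> (h *v axis i 1) = h $ j $ i" for i j
    by (simp add: inner_axis' matrix_vector_mult_basis column_def)
  then have "(\<integral>\<^sup>+v. \<integral>\<^sup>+w. ennreal (exp (w \<bullet> (h *v v) / t)) \<partial>basis_pmf \<mu> \<partial>basis_pmf \<mu>)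
    = (\<Sum>i\<in>UNIV. \<Sum>j\<in>UNIV. ennreal (\<mu> $ i * (\<mu> $ j * exp (h $ j $ i / t))))"
    using nn by (simp add: nn_integral_basis_pmf[OF mu] sum_distrib_left mult.commute
        mult.left_commute del: sum_ennreal flip: ennreal_mult)
  also have "\<dots> = ennreal (\<Sum>i\<in>UNIV. \<Sum>j\<in>UNIV. \<mu> $ i * \<mu> $ j * exp (h $ j $ i / t))"
    using nn by (simp add: sum_ennreal sum_nonneg mult.assoc)
  also have "(\<Sum>i\<in>UNIV. \<Sum>j\<in>UNIV. \<mu> $ i * \<mu> $ j * exp (h $ j $ i / t)) =
     (\<Sum>i\<in>UNIV. \<Sum>j\<in>UNIV. outer \<mu> \<mu> $ i $ j * exp (h $ i $ j / t))"
    by (subst sum.swap) (simp add: outer_def mult.commute)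
  finally show ?thesis .
qed

text \<open>
Jensen's inequality over the permutations bounds the exponential moment by an average of moments of independent
pairs. Each of these is the \<open>M\<close>-th power of the moment of a single pair, which is what the factor \<open>M\<close>
in the perspective parameter \<open>M * \<alpha>\<close> encodes.
\<close>

lemma exp_moment_trace_omega:
  fixes h :: "real ^ 'd ^ 'd"
  assumes K: "2 \<le> K" and M: "M = K div 2" and mu: "\<mu> \<in> vec_simplex" and \<alpha>: "0 < \<alpha>"
  shows "(\<integral>\<^sup>+\<zeta>. ennreal (exp (trace (h ** omega K \<zeta>) / \<alpha>)) \<partial>sample_pmf K \<mu>)
    \<le> ennreal (exp (perspective_lse (outer \<mu> \<mu>) h (real M * \<alpha>) / \<alpha>))"
proof -
  let ?P = "{p. p permutes {1..K}}"
  define n where "n = card ?P"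
  define t where "t = real M * \<alpha>"
  define S where "S = (\<Sum>i\<in>UNIV. \<Sum>j\<in>UNIV. outer \<mu> \<mu> $ i $ j * exp (h $ i $ j / t))"
  define B where "B p \<zeta> = (\<Prod>l<M. exp (\<zeta> (p (2 * l + 2)) \<bullet> (h *v \<zeta> (p (2 * l + 1))) / t))"
    for p :: "nat \<Rightarrow> nat" and \<zeta> :: "nat \<Rightarrow> real ^ 'd"
  have n: "n \<noteq> 0" by (simp add: n_def card_permutations[of _ K])
  have ne: "?P \<noteq> {}" using permutes_id by blast
  have finP: "finite ?P" by (simp add: finite_permutations)
  have M0: "0 < M" using K M by simp
  have S0: "0 < S" unfolding S_def by (rule weighted_exp_sum_pos[OF outer_weights[OF mu]])
  have jensen: "exp (trace (h ** omega K \<zeta>) / \<alpha>) \<le> (\<Sum>p\<in>?P. 1 / n * B p \<zeta>)" for \<zeta>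
  proof -
    define y where "y p = (\<Sum>l<M. \<zeta> (p (2 * l + 2)) \<bullet> (h *v \<zeta> (p (2 * l + 1))) / t)" for p
    have "trace (h ** omega K \<zeta>) / \<alpha> = (\<Sum>p\<in>?P. (1 / n) *\<^sub>R y p)"
      unfolding trace_omega_eq_average[OF K M] n_def
      by (simp add: sum_divide_distrib y_def t_def mult_ac)
    moreover have "exp (\<Sum>p\<in>?P. (1 / n) *\<^sub>R y p) \<le> (\<Sum>p\<in>?P. 1 / n * exp (y p))"
      using n by (intro convex_on_sum[OF finP ne exp_convex]) (auto simp: n_def simp del: One_nat_def)
    ultimately show ?thesis by (simp add: B_def y_def exp_sum)
  qed
  have block: "(\<integral>\<^sup>+\<zeta>. ennreal (B p \<zeta>) \<partial>sample_pmf K \<mu>) = ennreal (S ^ M)" if p: "p permutes {1..K}" for p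
  proof -
    have inj: "inj p" by (rule permutes_inj[OF p])
    have "(\<integral>\<^sup>+\<zeta>. ennreal (B p \<zeta>) \<partial>sample_pmf K \<mu>)
      = (\<integral>\<^sup>+v. \<integral>\<^sup>+w. ennreal (exp (w \<bullet> (h *v v) / t)) \<partial>basis_pmf \<mu> \<partial>basis_pmf \<mu>) ^ M"
      unfolding B_def sample_pmf_def prod_ennreal[OF exp_ge_zero, symmetric]
    proof (rule nn_integral_prod_disjoint_pairs)
      show "(\<lambda>l. p (2 * l + 1)) ` {..<M} \<subseteq> {1..K}" "(\<lambda>l. p (2 * l + 2)) ` {..<M} \<subseteq> {1..K}"
        unfolding image_subset_iff permutes_in_image[OF p] using M by auto
      show "(\<lambda>l. p (2 * l + 1)) ` {..<M} \<inter> (\<lambda>l. p (2 * l + 2)) ` {..<M} = {}"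
        by (auto simp: inj_eq[OF inj]) presburger
    qed (auto intro!: inj_onI simp: inj_eq[OF inj])
    then show ?thesis
      using S0 by (simp add: basis_pair_exp_moment[OF mu] S_def ennreal_power)
  qed
  have "(\<integral>\<^sup>+\<zeta>. ennreal (exp (trace (h ** omega K \<zeta>) / \<alpha>)) \<partial>sample_pmf K \<mu>)
    \<le> (\<integral>\<^sup>+\<zeta>. (\<Sum>p\<in>?P. ennreal (1 / real n) * ennreal (B p \<zeta>)) \<partial>sample_pmf K \<mu>)"
  proof (rule nn_integral_mono)
    fix \<zeta>
    have "(\<Sum>p\<in>?P. ennreal (1 / real n) * ennreal (B p \<zeta>)) = ennreal (\<Sum>p\<in>?P. 1 / n * B p \<zeta>)"
      by (subst sum_ennreal[symmetric]) (auto simp: B_def prod_nonneg simp del: sum_ennreal simp flip: ennreal_mult)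
    then show "ennreal (exp (trace (h ** omega K \<zeta>) / \<alpha>)) \<le> (\<Sum>p\<in>?P. ennreal (1 / real n) * ennreal (B p \<zeta>))"
      using jensen[of \<zeta>] by (simp add: ennreal_leI)
  qed
  also have "\<dots> = (\<Sum>p\<in>?P. ennreal (1 / real n) * ennreal (S ^ M))"
    by (subst nn_integral_sum) (auto simp: nn_integral_cmult block)
  also have "\<dots> = ennreal (\<Sum>p\<in>?P. 1 / n * S ^ M)"
    using S0 by (subst sum_ennreal[symmetric]) (auto simp del: sum_ennreal simp flip: ennreal_mult)
  also have "(\<Sum>p\<in>?P. 1 / n * S ^ M) = S ^ M" using n by (simp add: n_def)
  also have "S ^ M = exp (perspective_lse (outer \<mu> \<mu>) h (real M * \<alpha>) / \<alpha>)"
    using S0 \<alpha> by (simp add: perspective_lse_def S_def t_def exp_of_nat_mult)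
  finally show ?thesis .
qed

text \<open>
Markov's inequality for \<open>exp (trace (h ** omega K \<zeta>) / \<alpha>)\<close>; the exponential moment is cancelled by
the first summand of the threshold.
\<close>

lemma chernoff_trace_omega:
  fixes h :: "real ^ 'd ^ 'd"
  assumes K: "2 \<le> K" and M: "M = K div 2" and mu: "\<mu> \<in> vec_simplex" and \<alpha>: "0 < \<alpha>"
  shows "measure_pmf.prob (sample_pmf K \<mu>)
     {\<zeta>. trace (h ** omega K \<zeta>) > perspective_lse (outer \<mu> \<mu>) h (real M * \<alpha>) + \<alpha> * L} \<le> exp (- L)"
proof -
  define s where "s = perspective_lse (outer \<mu> \<mu>) h (real M * \<alpha>) + \<alpha> * L"
  define T where "T \<zeta> = trace (h ** omega K \<zeta>)" for \<zeta>
  let ?p = "sample_pmf K \<mu>"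
  have "emeasure ?p {\<zeta>. T \<zeta> > s} = (\<integral>\<^sup>+\<zeta>. indicator {\<zeta>. T \<zeta> > s} \<zeta> \<partial>?p)"
    by simp
  also have "\<dots> \<le> (\<integral>\<^sup>+\<zeta>. ennreal (exp (- s / \<alpha>)) * ennreal (exp (T \<zeta> / \<alpha>)) \<partial>?p)"
  proof (rule nn_integral_mono)
    fix \<zeta>
    show "indicator {\<zeta>. T \<zeta> > s} \<zeta> \<le> ennreal (exp (- s / \<alpha>)) * ennreal (exp (T \<zeta> / \<alpha>))"
      using \<alpha> by (auto simp: indicator_def field_simps simp flip: ennreal_mult exp_add ennreal_1 intro!: ennreal_leI)
  qed
  also have "\<dots> \<le> ennreal (exp (- s / \<alpha>)) * ennreal (exp (perspective_lse (outer \<mu> \<mu>) h (real M * \<alpha>) / \<alpha>))"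
    using exp_moment_trace_omega[OF K M mu \<alpha>, of h] by (simp add: nn_integral_cmult T_def mult_left_mono)
  also have "\<dots> = ennreal (exp (- L))"
    using \<alpha> by (simp add: s_def field_simps flip: ennreal_mult exp_add)
  finally show ?thesis
    by (simp add: T_def s_def measure_pmf.emeasure_eq_measure)
qed

section \<open>Tail probabilities and the risk as a least bound\<close>

text \<open>
An infimum over \<open>\<alpha>\<close>, or over admissible risk levels, need not be attained;
right-continuity of the tail lets a probability bound pass to it.
\<close>

lemma tail_right_continuous:
  fixes X :: "'a \<Rightarrow> real"
  assumes "\<And>t. a < t \<Longrightarrow> measure_pmf.prob p {x. X x > t} \<le> c"
  shows "measure_pmf.prob p {x. X x > a} \<le> c"
proof -
  let ?A = "\<lambda>n. {x. X x > a + 1 / real (Suc n)}"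
  have U: "(\<Union>n. ?A n) = {x. X x > a}"
  proof (intro equalityI subsetI)
    fix x assume "x \<in> {x. X x > a}"
    then obtain n where "inverse (real (Suc n)) < X x - a"
      using reals_Archimedean[of "X x - a"] by auto
    then show "x \<in> (\<Union>n. ?A n)" by (auto simp: field_simps intro!: exI[of _ n])
  qed (auto, smt (verit) divide_pos_pos of_nat_0_less_iff zero_less_Suc of_nat_Suc)
  have "incseq ?A"
  proof (rule incseq_SucI, rule subsetI)
    fix n x assume "x \<in> ?A n"
    moreover have "1 / real (Suc (Suc n)) \<le> 1 / real (Suc n)" by (simp add: field_simps)
    ultimately show "x \<in> ?A (Suc n)" by auto
  qed
  then have "(\<lambda>n. measure_pmf.prob p (?A n)) \<longlonglongrightarrow> measure_pmf.prob p (\<Union>n. ?A n)"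
    by (intro measure_pmf.finite_Lim_measure_incseq) auto
  then show ?thesis unfolding U
    by (rule LIMSEQ_le_const2) (use assms in auto)
qed

text \<open>
Admissible levels are nonnegative, because a negative level is exceeded with probability
\<open>1 > \<epsilon>\<close>. Hence they have an infimum, which is admissible by right-continuity, so the
least admissible level exists and the \<open>LEAST\<close> in the definition of the risk denotes it.
\<close>

lemma eps_risk_le:
  assumes U: "U \<noteq> {}" and \<epsilon>: "\<epsilon> < 1"
    and \<rho>: "\<And>u. u \<in> U \<Longrightarrow> measure_pmf.prob (sample_pmf K (A *v u)) {\<zeta>. \<bar>g \<zeta> - F u\<bar> > \<rho>} \<le> \<epsilon>"
  shows "eps_risk \<epsilon> K A U F g \<le> \<rho>"
proof -
  define P where "P r \<longleftrightarrow> (\<forall>u\<in>U. measure_pmf.prob (sample_pmf K (A *v u)) {\<zeta>. \<bar>g \<zeta> - F u\<bar> > r} \<le> \<epsilon>)" for r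
  have nonneg: "0 \<le> r" if "P r" for r
  proof (rule ccontr)
    assume "\<not> 0 \<le> r"
    obtain u where u: "u \<in> U" using U by blast
    have "{\<zeta>. \<bar>g \<zeta> - F u\<bar> > r} = UNIV" using \<open>\<not> 0 \<le> r\<close> by (auto intro: less_le_trans)
    then show False using that u \<epsilon> by (auto simp: P_def)
  qed
  have "P \<rho>" using \<rho> by (simp add: P_def)
  have bdd: "bdd_below (Collect P)" using nonneg by (intro bdd_belowI[of _ 0]) auto
  have "measure_pmf.prob (sample_pmf K (A *v u)) {\<zeta>. \<bar>g \<zeta> - F u\<bar> > Inf (Collect P)} \<le> \<epsilon>"
    if u: "u \<in> U" for u
  proof (rule tail_right_continuous)
    fix t assume "Inf (Collect P) < t"
    then obtain r where r: "P r" "r < t" using \<open>P \<rho>\<close> cInf_lessD[of "Collect P" t] by auto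
    have "measure_pmf.prob (sample_pmf K (A *v u)) {\<zeta>. \<bar>g \<zeta> - F u\<bar> > t}
      \<le> measure_pmf.prob (sample_pmf K (A *v u)) {\<zeta>. \<bar>g \<zeta> - F u\<bar> > r}"
      using r by (intro measure_pmf.finite_measure_mono) auto
    also have "\<dots> \<le> \<epsilon>" using r(1) u unfolding P_def by blast
    finally show "measure_pmf.prob (sample_pmf K (A *v u)) {\<zeta>. \<bar>g \<zeta> - F u\<bar> > t} \<le> \<epsilon>" .
  qed
  then have "P (Inf (Collect P))" by (simp add: P_def)
  then have "(LEAST r. P r) = Inf (Collect P)"
    by (rule Least_equality) (rule cInf_lower, simp, rule bdd)
  also have "\<dots> \<le> \<rho>" using bdd \<open>P \<rho>\<close> by (auto intro: cInf_lower)
  finally show ?thesis by (simp add: eps_risk_def P_def)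
qed

section \<open>Rank-one signals and the symmetry between the two bounds\<close>

lemma outer_mult_vec: "outer v w *v u = (w \<bullet> u) *\<^sub>R v"
  by (simp add: vec_eq_iff outer_def matrix_vector_mult_def inner_vec_def sum_distrib_left mult_ac)

lemma congruence_outer: "A ** outer u u ** transpose A = outer (A *v u) (A *v u)"
  by (simp add: vec_eq_iff outer_def matrix_matrix_mult_def matrix_vector_mult_def transpose_def
      sum_product sum_distrib_left sum_distrib_right mult_ac)

lemma stochastic_mult_vec_simplex:
  fixes A :: "real ^ 'm ^ 'd"
  assumes A: "\<And>j. column j A \<in> vec_simplex" and u: "u \<in> vec_simplex"
  shows "A *v u \<in> vec_simplex"
proof -
  have A0: "0 \<le> A $ i $ k" for i k using A by (auto simp: vec_simplex_def column_def)
  have A1: "(\<Sum>i\<in>UNIV. A $ i $ k) = 1" for k using A[of k] by (auto simp: vec_simplex_def column_def)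
  have "(\<Sum>i\<in>UNIV. (A *v u) $ i) = (\<Sum>i\<in>UNIV. \<Sum>k\<in>UNIV. A $ i $ k * u $ k)"
    by (simp add: matrix_vector_mult_def)
  also have "\<dots> = (\<Sum>k\<in>UNIV. (\<Sum>i\<in>UNIV. A $ i $ k) * u $ k)"
    unfolding sum_distrib_right by (rule sum.swap)
  finally show ?thesis using u A0 A1
    by (auto simp: vec_simplex_def matrix_vector_mult_def intro!: sum_nonneg)
qed

text \<open>
On the simplex the linear part of the functional is homogenised by \<open>1 = \<Sum>i. u $ i\<close>.
\<close>

lemma quad_fun_eq_trace:
  assumes "u \<in> vec_simplex"
  shows "quad_fun Q q u = trace (Qbar Q q ** outer u u)"
proof -
  have "vec 1 \<bullet> u = 1" using assms by (simp add: inner_vec_def vec_simplex_def)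
  then show ?thesis
    by (simp add: trace_mult_outer Qbar_def quad_fun_def matrix_vector_mult_add_rdistrib outer_mult_vec
        inner_add_right inner_commute)
qed

lemma trace_minus_mult: "trace (- B ** x) = - trace (B ** x)"
  for B :: "real ^ 'm ^ 'm"
  by (simp add: trace_def matrix_matrix_mult_def sum_negf)

lemma Psi_minus_eq_Psi_plus: "Psi_minus M A X B h \<alpha> = Psi_plus M A X (- B) (- h) \<alpha>"
  by (simp add: Psi_minus_def Psi_plus_def trace_minus_mult)

lemma Psi_hat_minus_eq_Psi_hat_plus: "Psi_hat_minus M A X B \<epsilon> h = Psi_hat_plus M A X (- B) \<epsilon> (- h)"
  by (simp add: Psi_hat_minus_def Psi_hat_plus_def Psi_minus_eq_Psi_plus)

section \<open>The upper bound, its saddle point and its tail guarantee\<close>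

text \<open>
One-sided half of the construction. The cost matrix \<open>B\<close> and \<open>h\<close> remain arguments of the
notions below, since the upper bound uses
them with \<open>Qbar Q q\<close> and \<open>h\<close>, the lower bound with \<open>- Qbar Q q\<close> and \<open>- h\<close>.
\<close>

locale lifted_signal_set =
  fixes M :: nat and A :: "real ^ 'm ^ 'd" and X :: "(real ^ 'm ^ 'm) set" and \<epsilon> :: real
  assumes M: "0 < M" and A: "\<And>j. column j A \<in> vec_simplex"
    and X: "convex X" "compact X" "X \<noteq> {}" "X \<subseteq> weights"
    and \<epsilon>: "0 < \<epsilon>" "\<epsilon> < 1"
begin

definition lifted_objective :: "real ^ 'm ^ 'm \<Rightarrow> real ^ 'd ^ 'd \<Rightarrow> real ^ 'm ^ 'm \<Rightarrow> real \<Rightarrow> real" where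
  "lifted_objective B h x \<alpha> = perspective_lse (A ** x ** transpose A) h (real M * \<alpha>) - trace (B ** x)"

abbreviation "level B h \<alpha> \<equiv> Psi_plus M A X B h \<alpha> + \<alpha> * ln (2 / \<epsilon>)"

definition optimal_level :: "real ^ 'm ^ 'm \<Rightarrow> real ^ 'd ^ 'd \<Rightarrow> real" where
  "optimal_level B h = Inf (level B h ` {0<..})"

lemma log_pos: "0 < ln (2 / \<epsilon>)"
  using \<epsilon> by simp

lemma Phi_eq_lifted_objective:
  "0 < \<alpha> \<Longrightarrow> \<alpha> * Phi M (h /\<^sub>R \<alpha>) (A ** x ** transpose A) - trace (B ** x) = lifted_objective B h x \<alpha>"
  using Phi_eq_perspective_lse[of \<alpha> M] M by (simp add: lifted_objective_def)

lemma congruence_in_weights: "x \<in> X \<Longrightarrow> A ** x ** transpose A \<in> weights"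
  using congruence_weights[OF A] X by blast

lemma congruence_combination:
  fixes x y :: "real ^ 'm ^ 'm"
  shows "A ** (a *\<^sub>R x + b *\<^sub>R y) ** transpose A
    = a *\<^sub>R (A ** x ** transpose A) + b *\<^sub>R (A ** y ** transpose A)"
proof -
  have "(C + D) ** E = C ** E + D ** E" for C D :: "real ^ 'm ^ 'd" and E :: "real ^ 'd ^ 'm"
    by (simp add: vec_eq_iff matrix_matrix_mult_def distrib_right sum.distrib)
  then show ?thesis by (simp add: matrix_add_ldistrib matrix_scalar_ac scalar_matrix_assoc)
qed

lemma lifted_objective_ge: "x \<in> X \<Longrightarrow> 0 < \<alpha> \<Longrightarrow> - norm h - trace (B ** x) \<le> lifted_objective B h x \<alpha>"
  unfolding lifted_objective_def using perspective_lse_ge[OF congruence_in_weights] M by simp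

lemma continuous_on_lifted_objective: "continuous_on X (\<lambda>x. lifted_objective B h x \<alpha>)"
proof -
  have "continuous_on X (\<lambda>x. A ** x ** transpose A)"
    unfolding matrix_matrix_mult_def by (intro continuous_intros)
  then have "continuous_on X (\<lambda>x. perspective_lse (A ** x ** transpose A) h (real M * \<alpha>))"
    by (rule continuous_on_compose2[OF perspective_lse_continuous_on]) (use congruence_in_weights in auto)
  moreover have "continuous_on X (\<lambda>x. trace (B ** x))"
    unfolding trace_def matrix_matrix_mult_def by (intro continuous_intros)
  ultimately show ?thesis unfolding lifted_objective_def by (intro continuous_intros)
qed

lemma concave_on_lifted_objective:
  assumes "0 < \<alpha>"
  shows "concave_on X (\<lambda>x. lifted_objective B h x \<alpha>)"
  unfolding concave_on_iff
proof (intro conjI ballI allI impI X)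
  fix x y and a b :: real
  assume xy: "x \<in> X" "y \<in> X" and ab: "0 \<le> a" "0 \<le> b" "a + b = 1"
  have "a * perspective_lse (A ** x ** transpose A) h (real M * \<alpha>)
      + b * perspective_lse (A ** y ** transpose A) h (real M * \<alpha>)
    \<le> perspective_lse (A ** (a *\<^sub>R x + b *\<^sub>R y) ** transpose A) h (real M * \<alpha>)"
    unfolding congruence_combination
    using xy ab assms M by (intro perspective_lse_concave congruence_in_weights) auto
  then show "a * lifted_objective B h x \<alpha> + b * lifted_objective B h y \<alpha> \<le> lifted_objective B h (a *\<^sub>R x + b *\<^sub>R y) \<alpha>"
    by (simp add: lifted_objective_def trace_mult_add trace_mult_scaleR algebra_simps)
qed

lemma lifted_objective_jointly_convex:
  assumes x: "x \<in> X" and "0 < \<alpha>1" "0 < \<alpha>2" and ab: "0 \<le> a" "0 \<le> b" "a + b = 1"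
  shows "lifted_objective B (a *\<^sub>R h1 + b *\<^sub>R h2) x (a * \<alpha>1 + b * \<alpha>2) \<le> a * lifted_objective B h1 x \<alpha>1 + b * lifted_objective B h2 x \<alpha>2"
proof -
  have "trace (B ** x) = a * trace (B ** x) + b * trace (B ** x)"
    using ab by (metis mult_1 distrib_right)
  moreover have "real M * (a * \<alpha>1 + b * \<alpha>2) = a * (real M * \<alpha>1) + b * (real M * \<alpha>2)"
    by (simp add: algebra_simps)
  ultimately show ?thesis
    using perspective_lse_convex[OF congruence_in_weights[OF x], of "real M * \<alpha>1" "real M * \<alpha>2" a b h1 h2]
      assms M by (simp add: lifted_objective_def right_diff_distrib)
qed

lemma Psi_plus_is_max: "0 < \<alpha> \<Longrightarrow> is_max_over X (\<lambda>x. lifted_objective B h x \<alpha>) (Psi_plus M A X B h \<alpha>)"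
proof -
  assume \<alpha>: "0 < \<alpha>"
  obtain x where x: "x \<in> X" "\<And>y. y \<in> X \<Longrightarrow> lifted_objective B h y \<alpha> \<le> lifted_objective B h x \<alpha>"
    using continuous_attains_sup[OF X(2,3) continuous_on_lifted_objective] by blast
  have "Psi_plus M A X B h \<alpha> = (SUP x\<in>X. lifted_objective B h x \<alpha>)"
    by (simp add: Psi_plus_def Phi_eq_lifted_objective[OF \<alpha>])
  also have "\<dots> = lifted_objective B h x \<alpha>" using x by (intro cSup_eq_maximum) auto
  finally show ?thesis using x by (auto simp: is_max_over_def)
qed

lemma lifted_objective_le_Psi_plus: "x \<in> X \<Longrightarrow> 0 < \<alpha> \<Longrightarrow> lifted_objective B h x \<alpha> \<le> Psi_plus M A X B h \<alpha>"
  using Psi_plus_is_max by (auto simp: is_max_over_def)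

lemma Psi_plus_jointly_convex:
  assumes \<alpha>: "0 < \<alpha>1" "0 < \<alpha>2" and ab: "0 \<le> a" "0 \<le> b" "a + b = 1"
  shows "Psi_plus M A X B (a *\<^sub>R h1 + b *\<^sub>R h2) (a * \<alpha>1 + b * \<alpha>2)
    \<le> a * Psi_plus M A X B h1 \<alpha>1 + b * Psi_plus M A X B h2 \<alpha>2"
proof -
  have "0 < a * \<alpha>1 + b * \<alpha>2"
    using convexD[OF convex_real_interval(3)[of 0], of \<alpha>1 \<alpha>2 a b] \<alpha> ab by simp
  then obtain x where x: "x \<in> X"
    "Psi_plus M A X B (a *\<^sub>R h1 + b *\<^sub>R h2) (a * \<alpha>1 + b * \<alpha>2) = lifted_objective B (a *\<^sub>R h1 + b *\<^sub>R h2) x (a * \<alpha>1 + b * \<alpha>2)"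
    using Psi_plus_is_max unfolding is_max_over_def by metis
  note x(2)
  also have "lifted_objective B (a *\<^sub>R h1 + b *\<^sub>R h2) x (a * \<alpha>1 + b * \<alpha>2) \<le> a * lifted_objective B h1 x \<alpha>1 + b * lifted_objective B h2 x \<alpha>2"
    by (rule lifted_objective_jointly_convex[OF x(1) \<alpha> ab])
  also have "\<dots> \<le> a * Psi_plus M A X B h1 \<alpha>1 + b * Psi_plus M A X B h2 \<alpha>2"
    using x \<alpha> ab by (intro add_mono mult_left_mono lifted_objective_le_Psi_plus)
  finally show ?thesis .
qed

lemma bdd_below_level: "bdd_below (level B h ` {0<..})"
proof -
  obtain x where x: "x \<in> X" using X by blast
  have "- norm h - trace (B ** x) \<le> level B h \<alpha>" if "0 < \<alpha>" for \<alpha>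
    using lifted_objective_ge[OF x that, of h B] lifted_objective_le_Psi_plus[OF x that, of B h] mult_pos_pos[OF that log_pos] by linarith
  then show ?thesis by (intro bdd_belowI2) auto
qed

lemma optimal_level_le: "0 < \<alpha> \<Longrightarrow> optimal_level B h \<le> level B h \<alpha>"
  unfolding optimal_level_def using bdd_below_level by (intro cINF_lower) auto

lemma level_near_optimal:
  assumes "optimal_level B h < t"
  obtains \<alpha> where "0 < \<alpha>" "level B h \<alpha> < t"
  using cInf_lessD[of "level B h ` {0<..}" t] assms unfolding optimal_level_def by auto

lemma Psi_hat_plus_eq_optimal_level: "Psi_hat_plus M A X B \<epsilon> h = ereal (optimal_level B h)"
  unfolding Psi_hat_plus_def optimal_level_def
  using ereal_Inf'[OF bdd_below_level, of B h] by (simp add: image_image)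

text \<open>
Partial minimisation of a jointly convex function; near-minimisers stand in for minimisers, which
may fail to exist because the range of \<open>\<alpha>\<close> is open and unbounded.
\<close>

lemma optimal_level_convex:
  assumes ab: "0 \<le> a" "0 \<le> b" "a + b = 1"
  shows "optimal_level B (a *\<^sub>R h1 + b *\<^sub>R h2) \<le> a * optimal_level B h1 + b * optimal_level B h2"
proof (rule field_le_epsilon)
  fix e :: real assume e: "0 < e"
  obtain \<alpha>1 where 1: "0 < \<alpha>1" "level B h1 \<alpha>1 < optimal_level B h1 + e" using level_near_optimal[of B h1 "optimal_level B h1 + e"] e by auto
  obtain \<alpha>2 where 2: "0 < \<alpha>2" "level B h2 \<alpha>2 < optimal_level B h2 + e" using level_near_optimal[of B h2 "optimal_level B h2 + e"] e by auto
  have "0 < a * \<alpha>1 + b * \<alpha>2"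
    using convexD[OF convex_real_interval(3)[of 0], of \<alpha>1 \<alpha>2 a b] 1 2 ab by simp
  then have "optimal_level B (a *\<^sub>R h1 + b *\<^sub>R h2) \<le> level B (a *\<^sub>R h1 + b *\<^sub>R h2) (a * \<alpha>1 + b * \<alpha>2)"
    by (rule optimal_level_le)
  also have "\<dots> \<le> a * level B h1 \<alpha>1 + b * level B h2 \<alpha>2"
    using Psi_plus_jointly_convex[OF 1(1) 2(1) ab, of B h1 h2] by (simp add: algebra_simps)
  also have "\<dots> \<le> a * (optimal_level B h1 + e) + b * (optimal_level B h2 + e)"
    by (rule add_mono[OF mult_left_mono mult_left_mono]) (use 1 2 ab in simp_all)
  also have "\<dots> = a * optimal_level B h1 + b * optimal_level B h2 + (a + b) * e" by (simp add: algebra_simps)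
  finally show "optimal_level B (a *\<^sub>R h1 + b *\<^sub>R h2) \<le> a * optimal_level B h1 + b * optimal_level B h2 + e" using ab by simp
qed

text \<open>
For each \<open>\<alpha>\<close> the maximiser over \<open>x\<close> has value at least \<open>optimal_level B h\<close>, so the minimax theorem
applies with this number as the level.
\<close>

lemma saddle_attained: "\<exists>x\<in>X. \<forall>\<alpha>\<in>{0<..}. optimal_level B h \<le> lifted_objective B h x \<alpha> + \<alpha> * ln (2 / \<epsilon>)"
proof (rule minimax_attained[OF X(1-3)])
  fix \<alpha> :: real assume \<alpha>: "\<alpha> \<in> {0<..}"
  show "concave_on X (\<lambda>x. lifted_objective B h x \<alpha> + \<alpha> * ln (2 / \<epsilon>))"
    using concave_on_lifted_objective[of \<alpha> B h] \<alpha> by (intro concave_on_add) (auto simp: concave_on_iff X simp flip: distrib_right)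
  show "continuous_on X (\<lambda>x. lifted_objective B h x \<alpha> + \<alpha> * ln (2 / \<epsilon>))"
    by (intro continuous_intros continuous_on_lifted_objective)
  show "\<exists>x\<in>X. optimal_level B h \<le> lifted_objective B h x \<alpha> + \<alpha> * ln (2 / \<epsilon>)"
    using Psi_plus_is_max[of \<alpha> B h] optimal_level_le[of \<alpha> B h] \<alpha>
    unfolding is_max_over_def by (metis greaterThan_iff)
next
  fix x assume x: "x \<in> X"
  have h: "h = a *\<^sub>R h + b *\<^sub>R h" if "a + b = 1" for a b :: real
    using that by (metis scaleR_left_distrib scaleR_one)
  show "convex_on {0<..} (\<lambda>\<alpha>. lifted_objective B h x \<alpha> + \<alpha> * ln (2 / \<epsilon>))"
    unfolding convex_on_def
  proof (intro conjI ballI allI impI)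
    fix \<alpha> \<beta> a b :: real
    assume *: "\<alpha> \<in> {0<..}" "\<beta> \<in> {0<..}" "0 \<le> a" "0 \<le> b" "a + b = 1"
    have "lifted_objective B h x (a * \<alpha> + b * \<beta>) \<le> a * lifted_objective B h x \<alpha> + b * lifted_objective B h x \<beta>"
      using lifted_objective_jointly_convex[OF x _ _ *(3-5), of \<alpha> \<beta> B h h] * by (simp flip: h)
    then show "lifted_objective B h x (a *\<^sub>R \<alpha> + b *\<^sub>R \<beta>) + (a *\<^sub>R \<alpha> + b *\<^sub>R \<beta>) * ln (2 / \<epsilon>)
      \<le> a * (lifted_objective B h x \<alpha> + \<alpha> * ln (2 / \<epsilon>)) + b * (lifted_objective B h x \<beta> + \<beta> * ln (2 / \<epsilon>))"
      by (simp add: algebra_simps)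
  qed simp
qed

lemma optimal_level_is_max:
  "is_max_over X (\<lambda>x. INF \<alpha>\<in>{0<..}. ereal (lifted_objective B h x \<alpha> + \<alpha> * ln (2 / \<epsilon>))) (ereal (optimal_level B h))"
proof -
  have le: "(INF \<alpha>\<in>{0<..}. ereal (lifted_objective B h x \<alpha> + \<alpha> * ln (2 / \<epsilon>))) \<le> ereal (optimal_level B h)" if "x \<in> X" for x
    unfolding Psi_hat_plus_eq_optimal_level[symmetric] Psi_hat_plus_def
    by (rule INF_mono) (use lifted_objective_le_Psi_plus[OF that] in \<open>force intro: add_right_mono\<close>)
  obtain x where x: "x \<in> X" "\<forall>\<alpha>\<in>{0<..}. optimal_level B h \<le> lifted_objective B h x \<alpha> + \<alpha> * ln (2 / \<epsilon>)"
    using saddle_attained by blast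
  have "ereal (optimal_level B h) \<le> (INF \<alpha>\<in>{0<..}. ereal (lifted_objective B h x \<alpha> + \<alpha> * ln (2 / \<epsilon>)))"
    using x by (intro INF_greatest) auto
  then show ?thesis using le x by (auto simp: is_max_over_def intro!: bexI[of _ x] antisym)
qed

lemma Psi_hat_plus_is_max:
  "is_max_over X (\<lambda>x. INF \<alpha>\<in>{0<..}. ereal (\<alpha> * Phi M (h /\<^sub>R \<alpha>) (A ** x ** transpose A)
     - trace (B ** x) + \<alpha> * ln (2 / \<epsilon>))) (Psi_hat_plus M A X B \<epsilon> h)"
  using optimal_level_is_max[of B h] by (simp add: Phi_eq_lifted_objective Psi_hat_plus_eq_optimal_level cong: INF_cong_simp)

lemma Psi_hat_plus_is_max_rescaled:
  "is_max_over X (\<lambda>x. INF \<beta>\<in>{0<..}. ereal (\<beta> * Phi 1 (h /\<^sub>R \<beta>) (A ** x ** transpose A)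
     - trace (B ** x) + \<beta> / real M * ln (2 / \<epsilon>))) (Psi_hat_plus M A X B \<epsilon> h)"
proof -
  have scale: "{0<..} = (\<lambda>\<alpha>. real M * \<alpha>) ` {0<..}"
    using M by (auto simp: image_iff intro!: bexI[of _ "_ / real M"])
  have substitute: "(INF \<beta>\<in>{0<..}. f \<beta>) = (INF \<alpha>\<in>{0<..}. f (real M * \<alpha>))" for f :: "real \<Rightarrow> ereal"
    by (subst scale) (simp add: image_image)
  have "(INF \<beta>\<in>{0<..}. ereal (\<beta> * Phi 1 (h /\<^sub>R \<beta>) (A ** x ** transpose A)
       - trace (B ** x) + \<beta> / real M * ln (2 / \<epsilon>)))
    = (INF \<alpha>\<in>{0<..}. ereal (lifted_objective B h x \<alpha> + \<alpha> * ln (2 / \<epsilon>)))" for x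
  proof (rule trans[OF substitute INF_cong[OF refl]])
    fix \<alpha> :: real assume "\<alpha> \<in> {0<..}"
    then have "0 < real M * \<alpha>" using M by simp
    from Phi_eq_perspective_lse[OF this, of 1 h "A ** x ** transpose A"] M
    show "ereal (real M * \<alpha> * Phi 1 (h /\<^sub>R (real M * \<alpha>)) (A ** x ** transpose A)
       - trace (B ** x) + real M * \<alpha> / real M * ln (2 / \<epsilon>)) = ereal (lifted_objective B h x \<alpha> + \<alpha> * ln (2 / \<epsilon>))"
      by (simp add: lifted_objective_def)
  qed
  then show ?thesis using optimal_level_is_max[of B h] by (simp add: Psi_hat_plus_eq_optimal_level)
qed

text \<open>
The point \<open>outer u u\<close> competes in the maximum that defines the bound, so for each \<open>\<alpha>\<close> the level
dominates the Chernoff threshold of the sample law \<open>A *v u\<close>, diminished by \<open>trace (B ** outer u u)\<close>;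
the failure probability is
\<open>exp (- ln (2 / \<epsilon>)) = \<epsilon> / 2\<close>.
\<close>

lemma trace_omega_tail:
  assumes K: "2 \<le> K" "M = K div 2" and u: "u \<in> vec_simplex" "outer u u \<in> X"
  shows "measure_pmf.prob (sample_pmf K (A *v u))
    {\<zeta>. trace (h ** omega K \<zeta>) - trace (B ** outer u u) > optimal_level B h} \<le> \<epsilon> / 2"
proof (rule tail_right_continuous)
  fix t assume "optimal_level B h < t"
  then obtain \<alpha> where \<alpha>: "0 < \<alpha>" "level B h \<alpha> < t" by (rule level_near_optimal)
  let ?p = "sample_pmf K (A *v u)"
  let ?s = "perspective_lse (outer (A *v u) (A *v u)) h (real M * \<alpha>) + \<alpha> * ln (2 / \<epsilon>)"
  have "?s - trace (B ** outer u u) < t"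
    using lifted_objective_le_Psi_plus[OF u(2) \<alpha>(1), of B h] \<alpha>(2) by (simp add: lifted_objective_def congruence_outer)
  then have "measure_pmf.prob ?p {\<zeta>. trace (h ** omega K \<zeta>) - trace (B ** outer u u) > t}
    \<le> measure_pmf.prob ?p {\<zeta>. trace (h ** omega K \<zeta>) > ?s}"
    by (intro measure_pmf.finite_measure_mono) auto
  also have "\<dots> \<le> exp (- ln (2 / \<epsilon>))"
    by (rule chernoff_trace_omega[OF K stochastic_mult_vec_simplex[OF A u(1)] \<alpha>(1)])
  also have "\<dots> = \<epsilon> / 2" using \<epsilon> by (simp add: exp_minus)
  finally show "measure_pmf.prob ?p {\<zeta>. trace (h ** omega K \<zeta>) - trace (B ** outer u u) > t} \<le> \<epsilon> / 2" .
qed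

end

section \<open>The two-sided estimate\<close>

lemma convex_sym_matrices: "convex sym_matrices"
  by (rule convexI) (simp add: sym_matrices_def transpose_def vec_eq_iff)

theorem proposition5p3:
  fixes K M :: nat
    and A :: "real ^ 'm ^ 'd"
    and U :: "(real ^ 'm) set"
    and Q :: "real ^ 'm ^ 'm"
    and q :: "real ^ 'm"
    and X :: "(real ^ 'm ^ 'm) set"
    and \<epsilon> :: real
  assumes "K \<ge> 2"
    and "M = K div 2"
    and "\<And>j. column j A \<in> vec_simplex"
    and "U \<noteq> {}" and "closed U" and "U \<subseteq> vec_simplex"
    and "Q \<in> sym_matrices"
    and "convex X" and "compact X" and "X \<subseteq> psd_matrices \<inter> mat_simplex"
    and "\<And>u. u \<in> U \<Longrightarrow> outer u u \<in> X"
    and "0 < \<epsilon>" and "\<epsilon> < 1"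
  shows
    "(\<forall>h\<in>sym_matrices. \<forall>\<alpha>>0.
        is_max_over X
          (\<lambda>x. \<alpha> * Phi M (h /\<^sub>R \<alpha>) (A ** x ** transpose A) - trace (Qbar Q q ** x))
          (Psi_plus M A X (Qbar Q q) h \<alpha>) \<and>
        is_max_over X
          (\<lambda>x. \<alpha> * Phi M (- h /\<^sub>R \<alpha>) (A ** x ** transpose A) + trace (Qbar Q q ** x))
          (Psi_minus M A X (Qbar Q q) h \<alpha>)) \<and>
     (\<forall>h\<in>sym_matrices.
        is_max_over X
          (\<lambda>x. INF \<alpha>\<in>{0<..}. ereal (\<alpha> * Phi M (h /\<^sub>R \<alpha>) (A ** x ** transpose A)
                 - trace (Qbar Q q ** x) + \<alpha> * ln (2 / \<epsilon>)))
          (Psi_hat_plus M A X (Qbar Q q) \<epsilon> h) \<and>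
        is_max_over X
          (\<lambda>x. INF \<beta>\<in>{0<..}. ereal (\<beta> * Phi 1 (h /\<^sub>R \<beta>) (A ** x ** transpose A)
                 - trace (Qbar Q q ** x) + \<beta> / real M * ln (2 / \<epsilon>)))
          (Psi_hat_plus M A X (Qbar Q q) \<epsilon> h) \<and>
        is_max_over X
          (\<lambda>x. INF \<alpha>\<in>{0<..}. ereal (\<alpha> * Phi M (- h /\<^sub>R \<alpha>) (A ** x ** transpose A)
                 + trace (Qbar Q q ** x) + \<alpha> * ln (2 / \<epsilon>)))
          (Psi_hat_minus M A X (Qbar Q q) \<epsilon> h) \<and>
        is_max_over X
          (\<lambda>x. INF \<beta>\<in>{0<..}. ereal (\<beta> * Phi 1 (- h /\<^sub>R \<beta>) (A ** x ** transpose A)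
                 + trace (Qbar Q q ** x) + \<beta> / real M * ln (2 / \<epsilon>)))
          (Psi_hat_minus M A X (Qbar Q q) \<epsilon> h)) \<and>
     (\<forall>h\<in>sym_matrices. \<bar>Psi_hat_plus M A X (Qbar Q q) \<epsilon> h\<bar> \<noteq> \<infinity> \<and>
                       \<bar>Psi_hat_minus M A X (Qbar Q q) \<epsilon> h\<bar> \<noteq> \<infinity>) \<and>
     convex_on sym_matrices (\<lambda>h. real_of_ereal (Psi_hat_plus M A X (Qbar Q q) \<epsilon> h)) \<and>
     convex_on sym_matrices (\<lambda>h. real_of_ereal (Psi_hat_minus M A X (Qbar Q q) \<epsilon> h)) \<and>
     convex_on sym_matrices (Psi_hat M A X (Qbar Q q) \<epsilon>) \<and>
     (\<forall>h\<in>sym_matrices.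
        eps_risk \<epsilon> K A U (quad_fun Q q) (g_hat K A X (Qbar Q q) \<epsilon> h)
          \<le> Psi_hat M A X (Qbar Q q) \<epsilon> h \<and>
        (\<forall>u\<in>U. measure_pmf.prob (sample_pmf K (A *v u))
             {\<zeta>. \<bar>quad_fun Q q u - g_hat K A X (Qbar Q q) \<epsilon> h \<zeta>\<bar> > Psi_hat M A X (Qbar Q q) \<epsilon> h}
           \<le> \<epsilon>))"
proof -
  have M: "0 < M" using assms(1,2) by simp
  have XW: "X \<subseteq> weights" using assms(10) by (auto simp: mat_simplex_def weights_def)
  have "X \<noteq> {}" using assms(4,11) by blast
  interpret lifted_signal_set M A X \<epsilon>
    by unfold_locales (fact M assms(3,8,9,12,13) XW \<open>X \<noteq> {}\<close>)+
  let ?B = "Qbar Q q"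
  note minus = Psi_hat_minus_eq_Psi_hat_plus Psi_hat_plus_eq_optimal_level
  have Psi_hat: "Psi_hat M A X ?B \<epsilon> h = (optimal_level ?B h + optimal_level (- ?B) (- h)) / 2" for h
    by (simp add: Psi_hat_def minus)
  have convex_plus: "convex_on sym_matrices (\<lambda>h. optimal_level ?B h)"
    unfolding convex_on_def using convex_sym_matrices optimal_level_convex by blast
  have convex_minus: "convex_on sym_matrices (\<lambda>h. optimal_level (- ?B) (- h))"
    unfolding convex_on_def
  proof (intro conjI convex_sym_matrices ballI allI impI)
    fix h1 h2 :: "real ^ 'd ^ 'd" and a b :: real
    assume "0 \<le> a" "0 \<le> b" "a + b = 1"
    from optimal_level_convex[OF this, of "- ?B" "- h1" "- h2"]
    show "optimal_level (- ?B) (- (a *\<^sub>R h1 + b *\<^sub>R h2)) \<le> a * optimal_level (- ?B) (- h1) + b * optimal_level (- ?B) (- h2)"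
      by simp
  qed
  have convex_sum: "convex_on sym_matrices (Psi_hat M A X ?B \<epsilon>)"
    unfolding Psi_hat[abs_def]
    using convex_on_cmul[OF _ convex_on_add[OF convex_plus convex_minus], of "1 / 2"] by simp
  have risk: "measure_pmf.prob (sample_pmf K (A *v u))
      {\<zeta>. \<bar>g_hat K A X ?B \<epsilon> h \<zeta> - quad_fun Q q u\<bar> > Psi_hat M A X ?B \<epsilon> h} \<le> \<epsilon>"
    if u: "u \<in> U" for u h
  proof -
    let ?p = "sample_pmf K (A *v u)"
    let ?T = "\<lambda>\<zeta>. trace (h ** omega K \<zeta>)" and ?F = "trace (?B ** outer u u)"
    let ?over = "{\<zeta>. ?T \<zeta> - ?F > optimal_level ?B h}"
    let ?under = "{\<zeta>. trace (- h ** omega K \<zeta>) - trace (- ?B ** outer u u) > optimal_level (- ?B) (- h)}"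
    have us: "u \<in> vec_simplex" "outer u u \<in> X" using u assms(6,11) by auto
    \<comment> \<open>The shift by \<open>kappa\<close> makes each one-sided deviation of the estimate beyond \<open>Psi_hat\<close> a
      deviation of the linear statistic beyond its own one-sided bound.\<close>
    have "{\<zeta>. \<bar>g_hat K A X ?B \<epsilon> h \<zeta> - quad_fun Q q u\<bar> > Psi_hat M A X ?B \<epsilon> h} \<subseteq> ?over \<union> ?under"
      by (auto simp: g_hat_def kappa_def Psi_hat minus quad_fun_eq_trace[OF us(1)] trace_minus_mult
          simp flip: assms(2)) argo
    then have "measure_pmf.prob ?p {\<zeta>. \<bar>g_hat K A X ?B \<epsilon> h \<zeta> - quad_fun Q q u\<bar> > Psi_hat M A X ?B \<epsilon> h}
      \<le> measure_pmf.prob ?p (?over \<union> ?under)"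
      by (intro measure_pmf.finite_measure_mono) auto
    also have "\<dots> \<le> measure_pmf.prob ?p ?over + measure_pmf.prob ?p ?under"
      by (rule measure_subadditive) auto
    also have "\<dots> \<le> \<epsilon> / 2 + \<epsilon> / 2"
      by (intro add_mono trace_omega_tail assms us)
    finally show ?thesis by simp
  qed
  show ?thesis
  proof (intro conjI ballI allI impI)
    fix h :: "real ^ 'd ^ 'd" and \<alpha> :: real assume \<alpha>: "0 < \<alpha>"
    show "is_max_over X
          (\<lambda>x. \<alpha> * Phi M (h /\<^sub>R \<alpha>) (A ** x ** transpose A) - trace (?B ** x))
          (Psi_plus M A X ?B h \<alpha>)"
      using Psi_plus_is_max[OF \<alpha>] by (simp add: Phi_eq_lifted_objective[OF \<alpha>])
    show "is_max_over X
          (\<lambda>x. \<alpha> * Phi M (- h /\<^sub>R \<alpha>) (A ** x ** transpose A) + trace (?B ** x))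
          (Psi_minus M A X ?B h \<alpha>)"
      using Psi_plus_is_max[OF \<alpha>, of "- ?B" "- h", folded Phi_eq_lifted_objective[OF \<alpha>]]
      by (simp add: trace_minus_mult Psi_minus_eq_Psi_plus)
  next
    fix h :: "real ^ 'd ^ 'd"
    show "is_max_over X
          (\<lambda>x. INF \<alpha>\<in>{0<..}. ereal (\<alpha> * Phi M (h /\<^sub>R \<alpha>) (A ** x ** transpose A)
                 - trace (?B ** x) + \<alpha> * ln (2 / \<epsilon>)))
          (Psi_hat_plus M A X ?B \<epsilon> h)"
      by (rule Psi_hat_plus_is_max)
    show "is_max_over X
          (\<lambda>x. INF \<beta>\<in>{0<..}. ereal (\<beta> * Phi 1 (h /\<^sub>R \<beta>) (A ** x ** transpose A)
                 - trace (?B ** x) + \<beta> / real M * ln (2 / \<epsilon>)))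
          (Psi_hat_plus M A X ?B \<epsilon> h)"
      by (rule Psi_hat_plus_is_max_rescaled)
    show "is_max_over X
          (\<lambda>x. INF \<alpha>\<in>{0<..}. ereal (\<alpha> * Phi M (- h /\<^sub>R \<alpha>) (A ** x ** transpose A)
                 + trace (?B ** x) + \<alpha> * ln (2 / \<epsilon>)))
          (Psi_hat_minus M A X ?B \<epsilon> h)"
      using Psi_hat_plus_is_max[of "- h" "- ?B"]
      unfolding Psi_hat_minus_eq_Psi_hat_plus trace_minus_mult diff_minus_eq_add .
    show "is_max_over X
          (\<lambda>x. INF \<beta>\<in>{0<..}. ereal (\<beta> * Phi 1 (- h /\<^sub>R \<beta>) (A ** x ** transpose A)
                 + trace (?B ** x) + \<beta> / real M * ln (2 / \<epsilon>)))
          (Psi_hat_minus M A X ?B \<epsilon> h)"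
      using Psi_hat_plus_is_max_rescaled[of "- h" "- ?B"]
      unfolding Psi_hat_minus_eq_Psi_hat_plus trace_minus_mult diff_minus_eq_add .
    show "\<bar>Psi_hat_plus M A X ?B \<epsilon> h\<bar> \<noteq> \<infinity>" "\<bar>Psi_hat_minus M A X ?B \<epsilon> h\<bar> \<noteq> \<infinity>"
      by (simp_all add: minus)
    show "eps_risk \<epsilon> K A U (quad_fun Q q) (g_hat K A X ?B \<epsilon> h) \<le> Psi_hat M A X ?B \<epsilon> h"
      by (intro eps_risk_le assms risk)
    show "measure_pmf.prob (sample_pmf K (A *v u))
             {\<zeta>. \<bar>quad_fun Q q u - g_hat K A X ?B \<epsilon> h \<zeta>\<bar> > Psi_hat M A X ?B \<epsilon> h} \<le> \<epsilon>"
      if "u \<in> U" for u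
      using risk[OF that, of h] by (simp add: abs_minus_commute)
  next
    show "convex_on sym_matrices (\<lambda>h. real_of_ereal (Psi_hat_plus M A X ?B \<epsilon> h))"
      using convex_plus by (simp add: minus)
    show "convex_on sym_matrices (\<lambda>h. real_of_ereal (Psi_hat_minus M A X ?B \<epsilon> h))"
      using convex_minus by (simp add: minus)
    show "convex_on sym_matrices (Psi_hat M A X ?B \<epsilon>)" by (rule convex_sum)
  qed
qed

end
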